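(* Let $T$ be a compact interval in $(0,\infty)\times\mathbb R^N$. Then there exist positive constants $C_3$ and $C_4$ such that for each fixed $(t,x)\in T$, $$\liminf_{r\to0}\sup_{(s,y)\in I_r(t,x)}\frac{|u(s,y)-u(t,x)|}{r^\alpha(\log\log(1/r))^{-\alpha}}\ge C_3\quad\text{a.s.,}$$ and $$\liminf_{r\to0}\inf_{(t,x)\in T}\sup_{(s,y)\in I_r(t,x)}\frac{|u(s,y)-u(t,x)|}{r^\alpha(\log(1/r))^{-\alpha}}\ge C_4\quad\text{a.s.}$$ In particular, $(t,x)\mapsto u(t,x)$ is almost surely nowhere differentiable on $(0,\infty)\times\mathbb R^N$.
   Context: Fix integers $N\ge1$, $d\ge1$, and $H\in[1/2,1)$, $\beta\in(0,N)$. Let $h_\beta:\mathbb R^N\to[0,\infty)$ be measurable with $c_1|\xi|^{-\beta}\le h_\beta(\xi)\le c_2|\xi|^{-\beta}$ for constants $0<c_1\le c_2<\infty$. Assume $N-2H-1<\beta<N-2H+1$ and set $\alpha=\frac{2H+1-N+\beta}{2}\in(0,1)$. For $t\ge0$, $x\in\mathbb R^N$, $\tau\in\mathbb R$, $\xi\in\mathbb R^N$ let $\mathcal F g_{t,x}(\tau,\xi)=\frac{e^{-ix\cdot\xi}}{2|\xi|}\Big(\frac{e^{-it\tau}-e^{it|\xi|}}{\tau+|\xi|}-\frac{e^{-it\tau}-e^{-it|\xi|}}{\tau-|\xi|}\Big)$. The field $u=(u_1,\dots,u_d)$ is the (continuous version of the) random field solution of $\partial_t^2u_j=\Delta u_j+\dot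 W_j$ on $[0,\infty)\times\mathbb R^N$ with zero initial data, where $\dot W_j$ are i.i.d. centered Gaussian noises with formal covariance $\rho_H(t-s)f_\beta(x-y)$ ($\rho_H=\delta$ if $H=1/2$, $\rho_H(r)=|r|^{2H-2}$ if $H>1/2$, $f_\beta$ the Fourier transform of $h_\beta(\xi)d\xi$). Concretely, $u_1,\dots,u_d$ are i.i.d. centered Gaussian random fields with $\mathbb E[u_1(t,x)u_1(s,y)]=c_H\int_{\mathbb R}\int_{\mathbb R^N}\mathcal F g_{t,x}(\tau,\xi)\overline{\mathcal F g_{s,y}(\tau,\xi)}\,|\tau|^{1-2H}h_\beta(\xi)\,d\xi\,d\tau$ for a constant $c_H>0$. Notation: $I_r(t,x)=[t-r,t+r]\times\prod_{\ell=1}^N[x_\ell-r,x_\ell+r]$. *)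

theory Defs
  imports "HOL-Probability.Probability"
begin

definition centered_gaussian_rv :: "'w measure \<Rightarrow> ('w \<Rightarrow> real) \<Rightarrow> bool" where
  "centered_gaussian_rv M X \<longleftrightarrow> X \<in> borel_measurable M \<and>
     (\<exists>\<sigma>::real. \<sigma> \<ge> 0 \<and> (\<forall>\<theta>::real.
        char (distr M borel X) \<theta> = complex_of_real (exp (- (\<sigma>\<^sup>2 * \<theta>\<^sup>2) / 2))))"

text \<open>Fourier transform of the fundamental solution of the wave equation, F g_{t,x}(tau,xi).\<close>
definition Fg :: "real \<Rightarrow> real^'n \<Rightarrow> real \<Rightarrow> real^'n \<Rightarrow> complex" where
  "Fg t x \<tau> \<xi> =
     exp (- \<i> * complex_of_real (x \<bullet> \<xi>)) / complex_of_real (2 * norm \<xi>) *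
     ((exp (- \<i> * complex_of_real (t * \<tau>)) - exp (\<i> * complex_of_real (t * norm \<xi>)))
         / complex_of_real (\<tau> + norm \<xi>)
      - (exp (- \<i> * complex_of_real (t * \<tau>)) - exp (- \<i> * complex_of_real (t * norm \<xi>)))
         / complex_of_real (\<tau> - norm \<xi>))"

definition wave_cov :: "real \<Rightarrow> real \<Rightarrow> (real^'n \<Rightarrow> real) \<Rightarrow> real \<Rightarrow> real^'n \<Rightarrow> real \<Rightarrow> real^'n \<Rightarrow> complex" where
  "wave_cov cH H h t x s y =
     complex_of_real cH *
     (LINT \<tau>|lborel. LINT \<xi>|lborel.
        Fg t x \<tau> \<xi> * cnj (Fg s y \<tau> \<xi>) *
        complex_of_real (\<bar>\<tau>\<bar> powr (1 - 2 * H) * h \<xi>))"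

definition I_box :: "real \<Rightarrow> real \<Rightarrow> real^'n \<Rightarrow> (real \<times> (real^'n)) set" where
  "I_box r t x = {(s, y). \<bar>s - t\<bar> \<le> r \<and> (\<forall>l. \<bar>y $ l - x $ l\<bar> \<le> r)}"

end

theory Submission
  imports Defs "HOL-Real_Asymp.Real_Asymp"
begin

text \<open>Fix a time \<open>t > 0\<close> and one component of \<open>u\<close>. Expanding the variance of
  \<open>\<Sum> z\<^sub>k u(t, x + k \<delta> e)\<close> in Fourier space and keeping only the frequencies
  \<open>\<tau> \<approx> norm \<xi> \<approx> 1/\<delta>\<close>, where the kernel resonates, Parseval's identity over one period in
  the direction \<open>e\<close> bounds it below by \<open>c \<delta>\<^sup>2\<^sup>\<alpha> \<Sum> z\<^sub>k\<^sup>2\<close>. For a Gaussian vector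
  such a bound on the covariance matrix makes the probability that \<open>n\<close> increments are all smaller
  than \<open>s \<delta>\<^sup>\<alpha>\<close> at most \<open>exp (-n)\<close>. With \<open>\<delta>\<close> of order \<open>r / log log (1/r)\<close> at a fixed
  point, or \<open>r / log (1/r)\<close> simultaneously on a grid of mesh \<open>r/2\<close>, the probabilities along
  \<open>r = 1/2^n\<close> are summable and the Borel-Cantelli lemma applies. At a point of differentiability
  the oscillation would be \<open>O(r)\<close>, which contradicts the uniform bound as \<open>\<alpha> < 1\<close>.\<close>

section \<open>Small balls of Gaussian vectors\<close>

text \<open>The obstacle is a variance bound that does not deteriorate with the number of points. At
  equal times the covariance is a nonnegative spectral integral in which the positions enter only
  through unimodular phases, so restricting the frequency domain can only decrease it. For points at
  spacing delta on a line the phases have period 2 pi / delta in one frequency coordinate, and a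
  full period fits among the frequencies of size 1/delta; hence the uniform constant. The power 2
  alpha is delta^(2H+1+beta) from the density times delta^(-N) from the volume of the frequency box.
  The rates count points: n points at spacing r/n cost exp(-n) at the threshold (r/n)^alpha. Along
  dyadic r a fixed point needs n of order log log (1/r) for summability, while a grid with
  polynomially many points in 1/r needs n of order log (1/r). The grid controls all of T by the
  triangle inequality: a large increment between two points near q forces a large increment from q
  to one of them.\<close>

text \<open>Levy uniqueness identifies the law with that of \<sigma> times a standard normal
  variable. This replaces the anonymous parameter of the characteristic function by the second
  moment, the quantity that covariances compute; \<sigma> = 0 is included.\<close>

lemma centered_gaussian_rv_square:
  assumes "centered_gaussian_rv M X" and "prob_space M"
  shows "integrable M (\<lambda>\<omega>. (X \<omega>)\<^sup>2)"
    and "char (distr M borel X) 1 = exp (- (LINT \<omega>|M. (X \<omega>)\<^sup>2) / 2)"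
proof -
  interpret prob_space M by fact
  interpret N: real_distribution std_normal_distribution by (rule real_dist_normal_dist)
  obtain \<sigma> :: real where [measurable]: "X \<in> borel_measurable M"
    and ch: "\<And>\<theta>. char (distr M borel X) \<theta> = exp (- (\<sigma>\<^sup>2 * \<theta>\<^sup>2) / 2)"
    using assms(1) unfolding centered_gaussian_rv_def by blast
  have "distr M borel X = distr std_normal_distribution borel (\<lambda>x. \<sigma> * x)"
  proof (rule Levy_uniqueness)
    show "real_distribution (distr M borel X)"
      by (simp add: real_distribution_distr)
    show "real_distribution (distr std_normal_distribution borel (\<lambda>x. \<sigma> * x))"
      by (rule N.real_distribution_distr) simp
    have "char (distr std_normal_distribution borel (\<lambda>x. \<sigma> * x)) \<theta> = char std_normal_distribution (\<theta> * \<sigma>)" for \<theta>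
      unfolding char_def by (subst integral_distr) (simp_all add: ac_simps)
    then show "char (distr M borel X) = char (distr std_normal_distribution borel (\<lambda>x. \<sigma> * x))"
      by (auto simp: fun_eq_iff ch char_std_normal_distribution power_mult_distrib mult.commute)
  qed
  note eq = this
  have "integrable (distr M borel X) (\<lambda>x. x\<^sup>2)"
    unfolding eq by (subst integrable_distr_eq)
      (simp_all add: power_mult_distrib integrable_std_normal_distribution_moment)
  then show "integrable M (\<lambda>\<omega>. (X \<omega>)\<^sup>2)"
    by (subst (asm) integrable_distr_eq) simp_all
  have "(LINT \<omega>|M. (X \<omega>)\<^sup>2) = (LINT x|distr M borel X. x\<^sup>2)"
    by (subst integral_distr) simp_all
  also have "\<dots> = \<sigma>\<^sup>2"
    unfolding eq using std_normal_distribution_even_moments(1)[of 1]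
    by (subst integral_distr) (simp_all add: power_mult_distrib)
  finally show "char (distr M borel X) 1 = exp (- (LINT \<omega>|M. (X \<omega>)\<^sup>2) / 2)"
    by (simp add: ch)
qed

text \<open>The product of the two Gaussian factors is \<open>v\<close> times the normal density of
  variance 1/(1+s^2), so the integral equals \<open>v\<close>. The bound 1/s is the gain per
  coordinate in the small ball estimate.\<close>

lemma std_normal_exp_square:
  fixes s :: real
  assumes "0 < s"
  shows "(LINT z|std_normal_distribution. exp (- (s\<^sup>2 * z\<^sup>2) / 2)) \<le> 1 / s"
proof -
  define v where "v = 1 / sqrt (1 + s\<^sup>2)"
  have v: "0 < v" "v\<^sup>2 = 1 / (1 + s\<^sup>2)"
    unfolding v_def by (simp_all add: power_divide add_pos_nonneg)
  have sum_ne: "1 + s\<^sup>2 \<noteq> 0" by (simp add: add_pos_nonneg less_imp_neq[symmetric])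
  have "std_normal_density z * exp (- (s\<^sup>2 * z\<^sup>2) / 2) = v * normal_density 0 v z" for z
  proof -
    have "- z\<^sup>2 / 2 + - (s\<^sup>2 * z\<^sup>2) / 2 = - z\<^sup>2 / (2 * v\<^sup>2)"
      unfolding v(2) using sum_ne by (simp add: field_simps)
    moreover have "sqrt (2 * pi * v\<^sup>2) = sqrt (2 * pi) * v"
      using v(1) by (simp add: real_sqrt_mult)
    ultimately show ?thesis
      using v(1) by (simp add: normal_density_def exp_add[symmetric])
  qed
  then have "(LINT z|std_normal_distribution. exp (- (s\<^sup>2 * z\<^sup>2) / 2)) = (LINT z|lborel. v * normal_density 0 v z)"
    by (subst integral_density) (simp_all add: normal_density_nonneg)
  also have "\<dots> = v" using v(1) by simp
  also have "v \<le> 1 / s"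
  proof -
    have "s \<le> sqrt (1 + s\<^sup>2)" by (rule real_le_rsqrt) simp
    then show ?thesis unfolding v_def using assms by (simp add: frac_le)
  qed
  finally show ?thesis .
qed

text \<open>Writing the Gaussian kernel as the characteristic function of auxiliary independent standard
  normal variables turns a small ball probability into an integral over the variances of all linear
  combinations; no conditioning is needed.\<close>

lemma gaussian_small_ball:
  fixes D :: "'i \<Rightarrow> 'w \<Rightarrow> real"
  assumes M: "prob_space M" and K: "finite K"
    and D [measurable]: "\<And>k. D k \<in> borel_measurable M"
    and gauss: "\<And>z. centered_gaussian_rv M (\<lambda>\<omega>. \<Sum>k\<in>K. z k * D k \<omega>)"
    and var: "\<And>z. \<sigma>\<^sup>2 * (\<Sum>k\<in>K. (z k)\<^sup>2) \<le> (LINT \<omega>|M. (\<Sum>k\<in>K. z k * D k \<omega>)\<^sup>2)"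
    and pos: "0 < \<sigma>" "0 < \<epsilon>"
  shows "measure M {\<omega>\<in>space M. \<forall>k\<in>K. \<bar>D k \<omega>\<bar> \<le> \<epsilon>} \<le> (exp (1/2) * \<epsilon> / \<sigma>) ^ card K"
proof -
  interpret prob_space M by fact
  interpret N: real_distribution std_normal_distribution by (rule real_dist_normal_dist)
  interpret P: product_sigma_finite "\<lambda>_::'i. std_normal_distribution" ..
  define \<Gamma> where "\<Gamma> = Pi\<^sub>M K (\<lambda>_. std_normal_distribution)"
  interpret G: prob_space \<Gamma> unfolding \<Gamma>_def by (rule prob_space_PiM) (rule N.prob_space_axioms)
  interpret MG: pair_prob_space M \<Gamma> ..
  have Gm [measurable]: "(\<lambda>z. z k) \<in> borel_measurable \<Gamma>" if "k \<in> K" for k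
    using measurable_component_singleton[OF that, of "\<lambda>_. std_normal_distribution"]
    unfolding \<Gamma>_def by (simp cong: measurable_cong_sets)
  let ?S = "\<lambda>z \<omega>. \<Sum>k\<in>K. z k * D k \<omega>"
  let ?f = "\<lambda>\<omega> z. iexp (?S z \<omega> / \<epsilon>)"
  have Sm [measurable]: "(\<lambda>(\<omega>, z). ?S z \<omega>) \<in> borel_measurable (M \<Otimes>\<^sub>M \<Gamma>)"
    unfolding split_beta' by (intro borel_measurable_sum borel_measurable_times) measurable
  have fm [measurable]: "(\<lambda>(\<omega>, z). ?f \<omega> z) \<in> borel_measurable (M \<Otimes>\<^sub>M \<Gamma>)"
    using Sm unfolding split_beta' by measurable
  have fint: "integrable (M \<Otimes>\<^sub>M \<Gamma>) (\<lambda>(\<omega>, z). ?f \<omega> z)"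
    by (rule MG.integrable_const_bound[where B = 1]) (auto simp: norm_exp_eq_Re)
  \<comment> \<open>The auxiliary normals are independent, so this integral factorises into
    characteristic functions.\<close>
  have inner: "(LINT z|\<Gamma>. ?f \<omega> z) = (\<Prod>k\<in>K. exp (- ((D k \<omega> / \<epsilon>)\<^sup>2) / 2))" for \<omega>
  proof -
    have "(LINT z|\<Gamma>. ?f \<omega> z) = (LINT z|\<Gamma>. (\<Prod>k\<in>K. iexp (D k \<omega> / \<epsilon> * z k)))"
      by (intro Bochner_Integration.integral_cong)
         (simp_all add: exp_sum[OF K, symmetric] sum_divide_distrib sum_distrib_left ac_simps)
    also have "\<dots> = (\<Prod>k\<in>K. char std_normal_distribution (D k \<omega> / \<epsilon>))"
      unfolding \<Gamma>_def char_def by (rule P.product_integral_prod[OF K]) (rule N.integrable_iexp, simp_all del: of_real_mult)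
    finally show ?thesis by (simp add: char_std_normal_distribution)
  qed
  \<comment> \<open>Dividing the coefficients by \<epsilon> allows evaluation of the characteristic
    function at 1, where only the variance enters.\<close>
  have outer: "(LINT \<omega>|M. ?f \<omega> z) = exp (- (LINT \<omega>|M. (?S z \<omega>)\<^sup>2) / (2 * \<epsilon>\<^sup>2))" for z
  proof -
    have "(LINT \<omega>|M. ?f \<omega> z) = char (distr M borel (\<lambda>\<omega>. \<Sum>k\<in>K. (z k / \<epsilon>) * D k \<omega>)) 1"
      unfolding char_def by (subst integral_distr) (simp_all add: sum_divide_distrib)
    also have "\<dots> = exp (- (LINT \<omega>|M. (\<Sum>k\<in>K. (z k / \<epsilon>) * D k \<omega>)\<^sup>2) / 2)"
      by (rule centered_gaussian_rv_square(2)[OF gauss M])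
    also have "(\<lambda>\<omega>. (\<Sum>k\<in>K. (z k / \<epsilon>) * D k \<omega>)\<^sup>2) = (\<lambda>\<omega>. (?S z \<omega>)\<^sup>2 / \<epsilon>\<^sup>2)"
      by (simp add: sum_divide_distrib[symmetric] power_divide)
    finally show ?thesis by (simp add: ac_simps)
  qed
  define E where "E = {\<omega>\<in>space M. \<forall>k\<in>K. \<bar>D k \<omega>\<bar> \<le> \<epsilon>}"
  have E [measurable]: "E \<in> sets M" unfolding E_def using K by measurable
  define c where "c = exp (1/2 :: real) ^ card K"
  \<comment> \<open>On \<open>E\<close> every quotient D/\<epsilon> lies in [-1,1], so each Gaussian
    factor is at least exp(-1/2). Compensating for it costs the factor exp(1/2) per
    coordinate.\<close>
  have bnd: "indicator E \<omega> \<le> c * (\<Prod>k\<in>K. exp (- ((D k \<omega> / \<epsilon>)\<^sup>2) / 2))" for \<omega>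
  proof (cases "\<omega> \<in> E")
    case True
    have "1 \<le> exp (1/2) * exp (- ((D k \<omega> / \<epsilon>)\<^sup>2) / 2)" if "k \<in> K" for k
    proof -
      have "\<bar>D k \<omega> / \<epsilon>\<bar> \<le> 1" using True that pos by (auto simp: E_def abs_divide)
      then have "(D k \<omega> / \<epsilon>)\<^sup>2 \<le> 1" by (simp add: abs_square_le_1)
      then show ?thesis by (simp add: exp_add[symmetric] field_simps)
    qed
    then have "1 \<le> (\<Prod>k\<in>K. exp (1/2) * exp (- ((D k \<omega> / \<epsilon>)\<^sup>2) / 2))"
      by (intro prod_ge_1) auto
    then show ?thesis using True by (simp add: prod.distrib c_def)
  qed (simp add: c_def prod_nonneg)
  let ?P = "\<lambda>\<omega>. \<Prod>k\<in>K. exp (- ((D k \<omega> / \<epsilon>)\<^sup>2) / 2)"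
  let ?V = "\<lambda>z. exp (- (LINT \<omega>|M. (?S z \<omega>)\<^sup>2) / (2 * \<epsilon>\<^sup>2))"
  let ?Q = "\<lambda>z. \<Prod>k\<in>K. exp (- ((\<sigma> / \<epsilon>)\<^sup>2 * (z k)\<^sup>2) / 2)"
  have Pint: "integrable M ?P"
    by (intro integrable_const_bound[where B = 1]) (auto intro!: AE_I2 prod_le_1 simp: abs_prod)
  have "complex_of_real (LINT \<omega>|M. ?P \<omega>) = (LINT \<omega>|M. (LINT z|\<Gamma>. ?f \<omega> z))"
    by (simp only: inner of_real_prod[symmetric] integral_complex_of_real)
  also have "\<dots> = (LINT z|\<Gamma>. (LINT \<omega>|M. ?f \<omega> z))"
    by (rule MG.Fubini_integral[symmetric, OF fint])
  also have "\<dots> = complex_of_real (LINT z|\<Gamma>. ?V z)"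
    unfolding outer by simp
  finally have swap: "(LINT \<omega>|M. ?P \<omega>) = (LINT z|\<Gamma>. ?V z)"
    by (simp only: of_real_eq_iff)
  have Qint: "integrable \<Gamma> ?Q"
    by (intro G.integrable_const_bound[where B = 1]) (auto intro!: AE_I2 prod_le_1 simp: abs_prod)
  \<comment> \<open>The variance hypothesis decouples the coordinates: the bound \<open>?Q\<close>
    is a product, so its integral splits into one-dimensional ones.\<close>
  have VQ: "?V z \<le> ?Q z" for z
  proof -
    have "- (LINT \<omega>|M. (?S z \<omega>)\<^sup>2) / (2 * \<epsilon>\<^sup>2) \<le> - (\<sigma>\<^sup>2 * (\<Sum>k\<in>K. (z k)\<^sup>2)) / (2 * \<epsilon>\<^sup>2)"
      using var[of z] by (intro divide_right_mono) auto
    also have "\<dots> = (\<Sum>k\<in>K. - ((\<sigma> / \<epsilon>)\<^sup>2 * (z k)\<^sup>2) / 2)"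
      by (simp add: sum_distrib_left sum_divide_distrib sum_negf power_divide ac_simps)
    finally show ?thesis by (simp add: exp_sum[OF K, symmetric])
  qed
  have "(LINT z|\<Gamma>. ?V z) \<le> (LINT z|\<Gamma>. ?Q z)"
    by (rule integral_mono'[OF Qint VQ]) (simp add: prod_nonneg)
  also have "\<dots> = (\<Prod>k\<in>K. (LINT z|std_normal_distribution. exp (- ((\<sigma> / \<epsilon>)\<^sup>2 * z\<^sup>2) / 2)))"
    unfolding \<Gamma>_def by (rule P.product_integral_prod[OF K])
      (rule N.integrable_const_bound[where B = 1], auto)
  also have "\<dots> \<le> (\<Prod>k\<in>K. 1 / (\<sigma> / \<epsilon>))"
    by (intro prod_mono conjI std_normal_exp_square) (use pos in \<open>auto simp: integral_nonneg_AE\<close>)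
  finally have "(LINT z|\<Gamma>. ?V z) \<le> (\<epsilon> / \<sigma>) ^ card K" by simp
  have "measure M E = (LINT \<omega>|M. indicator E \<omega>)" by simp
  also have "\<dots> \<le> (LINT \<omega>|M. c * ?P \<omega>)"
    by (intro integral_mono bnd integrable_mult_right Pint)
       (auto intro!: integrable_const_bound[where B = 1])
  also have "\<dots> = c * (LINT z|\<Gamma>. ?V z)" by (simp only: integral_mult_right_zero swap)
  also have "\<dots> \<le> c * (\<epsilon> / \<sigma>) ^ card K"
    by (rule mult_left_mono) (fact, simp add: c_def)
  finally show ?thesis
    by (simp add: E_def c_def power_mult_distrib power_divide)
qed

section \<open>The space-time Fourier kernel\<close>

text \<open>A substitute for polar coordinates: \<open>f\<close> is dominated by a series of
  multiples of ball indicators, whose volumes are explicit. All terms are nonnegative, so one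
  suitable \<open>k\<close> for each point is enough.\<close>

lemma nn_integral_le_cballs:
  fixes f :: "'a::euclidean_space \<Rightarrow> ennreal"
  assumes c: "\<And>k. 0 \<le> c k" and r: "\<And>k. 0 \<le> r k"
    and cover: "\<And>x. f x \<noteq> 0 \<Longrightarrow> \<exists>k. norm x \<le> r k \<and> f x \<le> ennreal (c k)"
    and S: "(\<lambda>k. c k * r k ^ DIM('a)) sums S"
  shows "(\<integral>\<^sup>+x. f x \<partial>lborel) \<le> ennreal (unit_ball_vol DIM('a) * S)"
proof -
  have "f x \<le> (\<Sum>k. ennreal (c k) * indicator (cball 0 (r k)) x)" for x
  proof (cases "f x = 0")
    case False
    then obtain k where k: "norm x \<le> r k" "f x \<le> ennreal (c k)" using cover by blast
    have "f x \<le> ennreal (c k) * indicator (cball 0 (r k)) x" using k by simp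
    also have "\<dots> = (\<Sum>i\<in>{k}. ennreal (c i) * indicator (cball 0 (r i)) x)"
      by (subst sum.insert) simp_all
    also have "\<dots> \<le> (\<Sum>k. ennreal (c k) * indicator (cball 0 (r k)) x)"
      by (rule sum_le_suminf) auto
    finally show ?thesis .
  qed simp
  then have "(\<integral>\<^sup>+x. f x \<partial>lborel) \<le> (\<integral>\<^sup>+x. (\<Sum>k. ennreal (c k) * indicator (cball 0 (r k)) x) \<partial>(lborel :: 'a measure))"
    by (intro nn_integral_mono)
  also have "\<dots> = (\<Sum>k. ennreal (c k) * emeasure lborel (cball 0 (r k) :: 'a set))"
    by (subst nn_integral_suminf)
       (auto simp: nn_integral_cmult_indicator simp del: indicator_simps intro!: borel_measurable_times_ennreal borel_measurable_indicator)
  also have "\<dots> = (\<Sum>k. ennreal (unit_ball_vol DIM('a) * (c k * r k ^ DIM('a))))"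
    using c r by (intro suminf_cong) (simp add: emeasure_cball ennreal_mult'[symmetric] ac_simps)
  also have "\<dots> = ennreal (unit_ball_vol DIM('a) * S)"
    using c r by (intro suminf_ennreal_eq sums_mult S) auto
  finally show ?thesis .
qed

lemma nn_integral_norm_powr_cball:
  fixes \<gamma> :: real
  assumes "0 \<le> \<gamma>" "\<gamma> < DIM('a::euclidean_space)"
  shows "\<exists>C\<ge>0. \<forall>a>0. (\<integral>\<^sup>+x. ennreal (norm x powr - \<gamma>) * indicator (cball 0 a) x \<partial>(lborel :: 'a measure))
           \<le> ennreal (C * a powr (DIM('a) - \<gamma>))"
proof -
  \<comment> \<open>The ratio of the contributions of consecutive shells; it is below 1 because
    \<gamma> is below the dimension.\<close>
  define q where "q = 2 powr (\<gamma> - DIM('a))"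
  have q: "0 < q" "q < 1" using assms unfolding q_def by (auto simp: powr_less_one)
  define S where "S = 2 powr \<gamma> * (1 / (1 - q))"
  show ?thesis
  proof (intro exI[of _ "unit_ball_vol DIM('a) * S"] conjI allI impI)
    show "0 \<le> unit_ball_vol DIM('a) * S" using q by (simp add: S_def)
    fix a :: real assume a: "0 < a"
    have "(\<integral>\<^sup>+x. ennreal (norm x powr - \<gamma>) * indicator (cball 0 a) x \<partial>(lborel :: 'a measure))
       \<le> ennreal (unit_ball_vol DIM('a) * (S * a powr (DIM('a) - \<gamma>)))"
    proof (rule nn_integral_le_cballs[where c = "\<lambda>k. (a / 2 ^ Suc k) powr - \<gamma>" and r = "\<lambda>k. a / 2 ^ k"])
      fix x :: 'a assume "ennreal (norm x powr - \<gamma>) * indicator (cball 0 a) x \<noteq> 0"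
      \<comment> \<open>The origin drops out because \<open>0 powr\<close> any exponent is
        0.\<close>
      then have x: "0 < norm x" "norm x \<le> a" by (auto split: split_indicator_asm)
      define k where "k = nat \<lfloor>log 2 (a / norm x)\<rfloor>"
      have "1 \<le> a / norm x" using x by simp
      then have "0 \<le> log 2 (a / norm x)" by simp
      then have k: "real k \<le> log 2 (a / norm x)" "log 2 (a / norm x) < real (Suc k)"
        unfolding k_def by linarith+
      have "2 powr real k \<le> a / norm x" "a / norm x < 2 powr real (Suc k)"
        using k x a by (simp_all add: powr_le_iff less_powr_iff)
      then have "2 ^ k \<le> a / norm x" "a / norm x < 2 ^ Suc k"
        by (simp_all only: powr_realpow)
      then have "norm x \<le> a / 2 ^ k" "a / 2 ^ Suc k \<le> norm x"
        using x by (simp_all add: field_simps)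
      moreover from this(2) have "norm x powr - \<gamma> \<le> (a / 2 ^ Suc k) powr - \<gamma>"
        using a assms by (intro powr_mono2') auto
      ultimately show "\<exists>k. norm x \<le> a / 2 ^ k \<and>
          ennreal (norm x powr - \<gamma>) * indicator (cball 0 a) x \<le> ennreal ((a / 2 ^ Suc k) powr - \<gamma>)"
        using x by (intro exI[of _ k]) (auto intro: ennreal_leI)
    next
      have "(a / 2 ^ Suc k) powr - \<gamma> * (a / 2 ^ k) ^ DIM('a) = (2 powr \<gamma> * a powr (DIM('a) - \<gamma>)) * q ^ k" for k
      proof -
        have 1: "(a / 2 ^ Suc k) powr - \<gamma> = a powr - \<gamma> * 2 powr (\<gamma> * Suc k)"
        proof -
          have "(2::real) ^ Suc k = 2 powr Suc k" by (simp only: powr_realpow)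
          then have "((2::real) ^ Suc k) powr \<gamma> = 2 powr (\<gamma> * Suc k)"
            by (simp only: powr_powr mult.commute)
          then show ?thesis
            using a by (simp add: powr_divide powr_minus_divide del: power_Suc)
        qed
        have 2: "(a / 2 ^ k) ^ DIM('a) = a powr DIM('a) * 2 powr (- real (k * DIM('a)))"
          using a by (simp add: powr_realpow power_divide powr_minus_divide power_mult[symmetric] del: of_nat_mult)
        have 3: "q ^ k = 2 powr ((\<gamma> - DIM('a)) * k)"
          unfolding q_def by (simp add: powr_powr powr_realpow[symmetric])
        have "a powr - \<gamma> * a powr DIM('a) = a powr (DIM('a) - \<gamma>)"
          by (simp add: powr_add[symmetric])
        moreover have "2 powr (\<gamma> * Suc k) * 2 powr (- real (k * DIM('a))) = 2 powr \<gamma> * 2 powr ((\<gamma> - DIM('a)) * k)"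
          by (simp add: powr_add[symmetric] algebra_simps)
        ultimately show ?thesis unfolding 1 2 3 by (simp add: ac_simps)
      qed
      moreover have "(\<lambda>k. (2 powr \<gamma> * a powr (DIM('a) - \<gamma>)) * q ^ k) sums ((2 powr \<gamma> * a powr (DIM('a) - \<gamma>)) * (1 / (1 - q)))"
        using q by (intro sums_mult geometric_sums) auto
      ultimately show "(\<lambda>k. (a / 2 ^ Suc k) powr - \<gamma> * (a / 2 ^ k) ^ DIM('a)) sums (S * a powr (DIM('a) - \<gamma>))"
        by (simp add: S_def ac_simps)
    qed (use a in auto)
    then show "(\<integral>\<^sup>+x. ennreal (norm x powr - \<gamma>) * indicator (cball 0 a) x \<partial>(lborel :: 'a measure))
       \<le> ennreal (unit_ball_vol DIM('a) * S * a powr (DIM('a) - \<gamma>))" by (simp add: ac_simps)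
  qed
qed

text \<open>The same argument with shells growing outwards; now the ratio is below 1 because the
  exponent exceeds the dimension.\<close>

lemma nn_integral_norm_powr_outside:
  fixes \<gamma> :: real
  assumes "DIM('a::euclidean_space) < \<gamma>"
  shows "(\<integral>\<^sup>+x. ennreal (norm x powr - \<gamma>) * indicator {x. 1 \<le> norm x} x \<partial>(lborel :: 'a measure)) < \<infinity>"
proof -
  define q where "q = 2 powr (DIM('a) - \<gamma>)"
  have q: "0 < q" "q < 1" using assms unfolding q_def by (auto simp: powr_less_one)
  have "(\<integral>\<^sup>+x. ennreal (norm x powr - \<gamma>) * indicator {x. 1 \<le> norm x} x \<partial>(lborel :: 'a measure))
      \<le> ennreal (unit_ball_vol DIM('a) * (2 ^ DIM('a) * (1 / (1 - q))))"
  proof (rule nn_integral_le_cballs[where c = "\<lambda>k. (2 ^ k) powr - \<gamma>" and r = "\<lambda>k. 2 ^ Suc k"])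
    fix x :: 'a assume "ennreal (norm x powr - \<gamma>) * indicator {x. 1 \<le> norm x} x \<noteq> 0"
    then have x: "1 \<le> norm x" by (auto split: split_indicator_asm)
    define k where "k = nat \<lfloor>log 2 (norm x)\<rfloor>"
    have "0 < norm x" using x by linarith
    then have "0 \<le> log 2 (norm x)" using x by simp
    then have k: "real k \<le> log 2 (norm x)" "log 2 (norm x) < real (Suc k)"
      unfolding k_def by linarith+
    have "2 powr real k \<le> norm x" "norm x < 2 powr real (Suc k)"
      using k \<open>0 < norm x\<close> by (simp_all add: powr_le_iff less_powr_iff)
    then have "2 ^ k \<le> norm x" "norm x < 2 ^ Suc k"
      by (simp_all only: powr_realpow)
    moreover from this(1) have "norm x powr - \<gamma> \<le> (2 ^ k) powr - \<gamma>"
      using assms by (intro powr_mono2') auto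
    ultimately show "\<exists>k. norm x \<le> 2 ^ Suc k \<and>
        ennreal (norm x powr - \<gamma>) * indicator {x. 1 \<le> norm x} x \<le> ennreal ((2 ^ k) powr - \<gamma>)"
      using x by (intro exI[of _ k]) (auto intro: ennreal_leI)
  next
    have "(2 ^ k) powr - \<gamma> * (2 ^ Suc k) ^ DIM('a) = 2 ^ DIM('a) * q ^ k" for k
    proof -
      have 1: "(2 ^ k) powr - \<gamma> = 2 powr (- \<gamma> * k)"
        by (simp add: powr_powr powr_realpow[symmetric] ac_simps)
      have 2: "(2 ^ k :: real) ^ DIM('a) = 2 powr (DIM('a) * k)"
        by (simp add: powr_realpow[symmetric] powr_powr power_mult[symmetric] mult.commute)
      have 3: "q ^ k = 2 powr ((DIM('a) - \<gamma>) * k)"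
        unfolding q_def by (simp add: powr_powr powr_realpow[symmetric])
      have "2 powr (- \<gamma> * k) * 2 powr (DIM('a) * k) = 2 powr ((DIM('a) - \<gamma>) * k)"
        by (simp add: powr_add[symmetric] algebra_simps)
      then show ?thesis unfolding 3 power_Suc power_mult_distrib 1 2 by (simp add: ac_simps)
    qed
    moreover have "(\<lambda>k. 2 ^ DIM('a) * q ^ k) sums (2 ^ DIM('a) * (1 / (1 - q)))"
      using q by (intro sums_mult geometric_sums) auto
    ultimately show "(\<lambda>k. (2 ^ k) powr - \<gamma> * (2 ^ Suc k) ^ DIM('a)) sums (2 ^ DIM('a) * (1 / (1 - q)))"
      by (simp only: )
  qed auto
  then show ?thesis by (rule order.strict_trans1) simp
qed

text \<open>A single constant for all shifts is essential, since the kernel has its peaks at \<tau>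
  = \<rho> and \<tau> = -\<rho> with \<rho> varying.\<close>

lemma nn_integral_inverse_1_plus_square:
  "\<exists>P\<ge>0. \<forall>a. (\<integral>\<^sup>+\<tau>. ennreal (1 / (1 + (\<tau> - a)\<^sup>2)) \<partial>lborel) = ennreal P"
proof -
  have "integrable lborel (\<lambda>x::real. 1 / (1 + x\<^sup>2))"
    using integrable_inverse_1_plus_square by (simp add: set_integrable_def inverse_eq_divide)
  then have "(\<integral>\<^sup>+x. ennreal (1 / (1 + x\<^sup>2)) \<partial>(lborel::real measure)) = ennreal (LINT x|lborel. 1 / (1 + x\<^sup>2))"
    by (intro nn_integral_eq_integral) auto
  moreover have "(\<integral>\<^sup>+\<tau>. ennreal (1 / (1 + \<tau>\<^sup>2)) \<partial>lborel) = (\<integral>\<^sup>+\<tau>. ennreal (1 / (1 + (\<tau> - a)\<^sup>2)) \<partial>lborel)" for a :: real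
    by (subst nn_integral_real_affine[of _ 1 "- a"]) auto
  ultimately show ?thesis
    by (intro exI[of _ "LINT x|lborel. 1 / (1 + x\<^sup>2)"]) (auto intro!: integral_nonneg_AE)
qed

section \<open>Bounds for the temporal factor of the Fourier kernel\<close>

text \<open>What remains of \<open>Fg\<close> without the phase in x; it depends on \<xi> only
  through its norm \<rho>. Off the resonances it is the Duhamel integral of exp(-i s \<tau>)
  sin((t-s)\<rho>)/\<rho> over s in [0,t].\<close>

definition wave_kernel :: "real \<Rightarrow> real \<Rightarrow> real \<Rightarrow> complex" where
  "wave_kernel t \<tau> \<rho> =
     ((cis (- (t * \<tau>)) - cis (t * \<rho>)) / complex_of_real (\<tau> + \<rho>)
      - (cis (- (t * \<tau>)) - cis (- (t * \<rho>))) / complex_of_real (\<tau> - \<rho>)) / complex_of_real (2 * \<rho>)"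

lemma Fg_eq: "Fg t x \<tau> \<xi> = cis (- (x \<bullet> \<xi>)) * wave_kernel t \<tau> (norm \<xi>)"
  unfolding Fg_def wave_kernel_def cis_conv_exp by (simp add: ac_simps)

lemma cmod_cis_diff_le: "cmod (cis a - cis b) \<le> \<bar>a - b\<bar>"
proof -
  have "cis a - cis b = cis b * (cis (a - b) - 1)"
    by (simp add: cis_mult right_diff_distrib)
  then have "cmod (cis a - cis b) = cmod (iexp (a - b) - 1)"
    by (simp add: norm_mult cis_conv_exp)
  also have "\<dots> \<le> \<bar>a - b\<bar>"
    using iexp_approx1[of "a - b" 0] by simp
  finally show ?thesis .
qed

text \<open>The numerator is bounded both by 2 and by t times the denominator. Adding the two
  squared bounds, the first one multiplied by \<open>w\<close>, interpolates between them without a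
  case distinction.\<close>

lemma quotient_square_le:
  assumes "0 \<le> t"
  shows "(cmod ((cis (- (t * \<tau>)) - cis (- (t * z))) / complex_of_real (\<tau> - z)))\<^sup>2
    \<le> (t\<^sup>2 + 4) / (1 + (\<tau> - z)\<^sup>2)"
proof (cases "\<tau> = z")
  case False
  define D where "D = (cmod (cis (- (t * \<tau>)) - cis (- (t * z))))\<^sup>2"
  define w where "w = (\<tau> - z)\<^sup>2"
  have w: "0 < w" using False by (simp add: w_def)
  have "cmod (cis (- (t * \<tau>)) - cis (- (t * z))) \<le> 2"
    using norm_triangle_ineq4[of "cis (- (t * \<tau>))" "cis (- (t * z))"] by simp
  then have "D \<le> 2\<^sup>2" unfolding D_def by (intro power_mono) auto
  moreover have "D \<le> t\<^sup>2 * w"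
  proof -
    have "cmod (cis (- (t * \<tau>)) - cis (- (t * z))) \<le> \<bar>t * (\<tau> - z)\<bar>"
      using cmod_cis_diff_le[of "- (t * \<tau>)" "- (t * z)"] by (simp add: algebra_simps abs_minus_commute)
    then have "D \<le> \<bar>t * (\<tau> - z)\<bar>\<^sup>2" unfolding D_def by (intro power_mono) auto
    then show ?thesis by (simp add: w_def power_mult_distrib)
  qed
  ultimately have "D + D * w \<le> t\<^sup>2 * w + 4 * w"
    using w by (intro add_mono mult_right_mono) auto
  then have "D * (1 + w) \<le> (t\<^sup>2 + 4) * w" by (simp add: algebra_simps)
  then have "D / w \<le> (t\<^sup>2 + 4) / (1 + w)" using w by (simp add: divide_simps)
  then show ?thesis unfolding D_def w_def norm_divide power_divide norm_of_real by simp
qed simp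

text \<open>Writing \<rho> as -(-\<rho>) gives both quotients the form of
  \<open>quotient_square_le\<close>, with z = -\<rho> and z = \<rho>.\<close>

lemma wave_kernel_split:
  "wave_kernel t \<tau> \<rho> = ((cis (- (t * \<tau>)) - cis (- (t * (- \<rho>)))) / complex_of_real (\<tau> - (- \<rho>))
      - (cis (- (t * \<tau>)) - cis (- (t * \<rho>))) / complex_of_real (\<tau> - \<rho>)) / complex_of_real (2 * \<rho>)"
  by (simp add: wave_kernel_def)

lemma wave_kernel_le_high:
  assumes "0 \<le> t" "0 < \<rho>"
  shows "(cmod (wave_kernel t \<tau> \<rho>))\<^sup>2
    \<le> (t\<^sup>2 + 4) / \<rho>\<^sup>2 * (1 / (1 + (\<tau> - (- \<rho>))\<^sup>2) + 1 / (1 + (\<tau> - \<rho>)\<^sup>2))"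
proof -
  define A where "A = (cis (- (t * \<tau>)) - cis (- (t * (- \<rho>)))) / complex_of_real (\<tau> - (- \<rho>))"
  define B where "B = (cis (- (t * \<tau>)) - cis (- (t * \<rho>))) / complex_of_real (\<tau> - \<rho>)"
  have "(cmod (A - B))\<^sup>2 \<le> (cmod A + cmod B)\<^sup>2"
    by (intro power_mono norm_triangle_ineq4) simp
  also have "\<dots> \<le> 2 * ((cmod A)\<^sup>2 + (cmod B)\<^sup>2)"
    using sum_squares_bound[of "cmod A" "cmod B"] by (simp add: power2_sum)
  also have "\<dots> \<le> 2 * ((t\<^sup>2 + 4) / (1 + (\<tau> - (- \<rho>))\<^sup>2) + (t\<^sup>2 + 4) / (1 + (\<tau> - \<rho>)\<^sup>2))"
    unfolding A_def B_def using assms by (intro mult_left_mono add_mono quotient_square_le) auto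
  finally have AB: "(cmod (A - B))\<^sup>2 \<le> 2 * ((t\<^sup>2 + 4) / (1 + (\<tau> - (- \<rho>))\<^sup>2) + (t\<^sup>2 + 4) / (1 + (\<tau> - \<rho>)\<^sup>2))" .
  have "(cmod (wave_kernel t \<tau> \<rho>))\<^sup>2 = (cmod (A - B))\<^sup>2 / (4 * \<rho>\<^sup>2)"
    unfolding wave_kernel_split A_def B_def norm_divide power_divide norm_of_real by (simp add: power_mult_distrib)
  \<comment> \<open>The factor 2 is relaxed to 4 so that it cancels against the denominator.\<close>
  also have "\<dots> \<le> 4 * ((t\<^sup>2 + 4) / (1 + (\<tau> - (- \<rho>))\<^sup>2) + (t\<^sup>2 + 4) / (1 + (\<tau> - \<rho>)\<^sup>2)) / (4 * \<rho>\<^sup>2)"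
    by (rule divide_right_mono, rule order.trans[OF AB]) (rule mult_right_mono, auto intro!: add_nonneg_nonneg divide_nonneg_nonneg)
  also have "\<dots> = (t\<^sup>2 + 4) / \<rho>\<^sup>2 * (1 / (1 + (\<tau> - (- \<rho>))\<^sup>2) + 1 / (1 + (\<tau> - \<rho>)\<^sup>2))"
  proof -
    have "4 * (X / a + X / b) / (4 * r) = X / r * (1 / a + 1 / b)" for X a b r :: real
      by (cases "r = 0"; cases "a = 0"; cases "b = 0") (simp_all add: field_simps)
    then show ?thesis .
  qed
  finally show ?thesis .
qed

text \<open>For small \<rho> the factor 1/\<rho> has to be compensated by cancellation between the
  two quotients. In the Duhamel integral this is the bound |sin((t-s)\<rho>)| \<le> t
  \<rho>.\<close>

lemma wave_kernel_le_t_square: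
  assumes "0 \<le> t" "0 < \<rho>" "\<tau> \<noteq> \<rho>" "\<tau> \<noteq> - \<rho>"
  shows "cmod (wave_kernel t \<tau> \<rho>) \<le> t\<^sup>2"
proof (cases "t = 0")
  case False
  \<comment> \<open>An antiderivative of 2 sin((t-s)\<rho>) exp(-i s \<tau>). Its increment over
    [0,t] is 2\<rho> times the kernel, and its derivative is a difference of two phases that are
    2(t-s)\<rho> apart.\<close>
  define F where "F s = cis (- (s * \<tau>) + (t - s) * \<rho>) / complex_of_real (\<tau> + \<rho>)
      - cis (- (s * \<tau>) - (t - s) * \<rho>) / complex_of_real (\<tau> - \<rho>)" for s
  have nz: "\<tau> + \<rho> \<noteq> 0" "\<tau> - \<rho> \<noteq> 0" using assms by auto
  have der: "(F has_vector_derivative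
      (- \<i> * cis (- (s * \<tau>) + (t - s) * \<rho>) + \<i> * cis (- (s * \<tau>) - (t - s) * \<rho>))) (at s)" for s
  proof -
    have "(F has_derivative (\<lambda>h. (h * - (\<tau> + \<rho>)) *\<^sub>R (\<i> * cis (- (s * \<tau>) + (t - s) * \<rho>)) / complex_of_real (\<tau> + \<rho>)
        - (h * - (\<tau> - \<rho>)) *\<^sub>R (\<i> * cis (- (s * \<tau>) - (t - s) * \<rho>)) / complex_of_real (\<tau> - \<rho>))) (at s)"
    proof -
      have d: "((\<lambda>s. cis (g s) / c) has_derivative (\<lambda>h. (h * k) *\<^sub>R (\<i> * cis (g s)) / c)) (at s)"
        if "(g has_derivative (\<lambda>h. h * k)) (at s)" for g :: "real \<Rightarrow> real" and c k
        by (intro bounded_linear.has_derivative[OF bounded_linear_divide] has_derivative_cis that)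
      show ?thesis unfolding F_def
        by (intro has_derivative_diff d) (auto intro!: derivative_eq_intros simp: algebra_simps)
    qed
    also have "(\<lambda>h. (h * - (\<tau> + \<rho>)) *\<^sub>R (\<i> * cis (- (s * \<tau>) + (t - s) * \<rho>)) / complex_of_real (\<tau> + \<rho>)
        - (h * - (\<tau> - \<rho>)) *\<^sub>R (\<i> * cis (- (s * \<tau>) - (t - s) * \<rho>)) / complex_of_real (\<tau> - \<rho>))
      = (\<lambda>h. h *\<^sub>R (- \<i> * cis (- (s * \<tau>) + (t - s) * \<rho>) + \<i> * cis (- (s * \<tau>) - (t - s) * \<rho>)))"
    proof
      fix h
      have nz': "complex_of_real (\<tau> + \<rho>) \<noteq> 0" "complex_of_real (\<tau> - \<rho>) \<noteq> 0"
        using nz by (simp_all only: of_real_eq_0_iff not_False_eq_True)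
      have r: "(h * - z) *\<^sub>R (\<i> * w) / complex_of_real z = - h *\<^sub>R (\<i> * w)" if "complex_of_real z \<noteq> 0" for z w
        using that by (simp add: scaleR_conv_of_real)
      show "(h * - (\<tau> + \<rho>)) *\<^sub>R (\<i> * cis (- (s * \<tau>) + (t - s) * \<rho>)) / complex_of_real (\<tau> + \<rho>)
        - (h * - (\<tau> - \<rho>)) *\<^sub>R (\<i> * cis (- (s * \<tau>) - (t - s) * \<rho>)) / complex_of_real (\<tau> - \<rho>)
        = h *\<^sub>R (- \<i> * cis (- (s * \<tau>) + (t - s) * \<rho>) + \<i> * cis (- (s * \<tau>) - (t - s) * \<rho>))"
        by (simp only: r[OF nz'(1)] r[OF nz'(2)] scaleR_right_distrib) simp
    qed
    finally show ?thesis unfolding has_vector_derivative_def .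
  qed
  have "\<exists>s\<in>{0<..<t}. cmod (F t - F 0) \<le> cmod ((t - 0) *\<^sub>R (- \<i> * cis (- (s * \<tau>) + (t - s) * \<rho>) + \<i> * cis (- (s * \<tau>) - (t - s) * \<rho>)))"
  proof (rule mvt_general)
    show "0 < t" using False assms by simp
    show "continuous_on {0..t} F"
      by (intro continuous_at_imp_continuous_on ballI has_vector_derivative_continuous[OF der])
    show "(F has_derivative (\<lambda>h. h *\<^sub>R (- \<i> * cis (- (s * \<tau>) + (t - s) * \<rho>) + \<i> * cis (- (s * \<tau>) - (t - s) * \<rho>)))) (at s)" for s
      by (rule der[unfolded has_vector_derivative_def])
  qed
  then obtain s where s: "0 < s" "s < t"
    and le: "cmod (F t - F 0) \<le> t * cmod (cis (- (s * \<tau>) + (t - s) * \<rho>) - cis (- (s * \<tau>) - (t - s) * \<rho>))"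
    using False assms(1) by (auto simp: norm_mult minus_mult_right[symmetric] ring_distribs(4)[symmetric] norm_minus_commute
       simp flip: right_diff_distrib)
  note le
  also have "t * cmod (cis (- (s * \<tau>) + (t - s) * \<rho>) - cis (- (s * \<tau>) - (t - s) * \<rho>)) \<le> t * (2 * ((t - s) * \<rho>))"
    by (rule mult_left_mono, rule order.trans[OF cmod_cis_diff_le]) (use s assms in \<open>simp_all add: abs_mult\<close>)
  also have "t * (2 * ((t - s) * \<rho>)) \<le> t * (2 * (t * \<rho>))"
    using s assms by (intro mult_left_mono mult_right_mono) auto
  also have "F t - F 0 = wave_kernel t \<tau> \<rho> * complex_of_real (2 * \<rho>)"
  proof -
    have c: "X / c * c = X" if "c \<noteq> 0" for X c :: complex using that by simp
    have "complex_of_real (2 * \<rho>) \<noteq> 0" using assms(2) by simp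
    note c = c[OF this]
    show ?thesis unfolding wave_kernel_def c
      by (simp add: F_def diff_divide_distrib)
  qed
  finally show ?thesis using assms by (simp add: norm_mult power2_eq_square)
qed (simp add: wave_kernel_def)

text \<open>For bounded \<tau> the preceding bound suffices. For |\<tau>| > 2 both resonances are at
  distance more than 1, and a common denominator exhibits decay in \<tau> that is uniform as \<rho>
  tends to 0.\<close>

lemma wave_kernel_le_low:
  assumes "0 \<le> t" "0 < \<rho>" "\<rho> \<le> 1" "\<tau> \<noteq> \<rho>" "\<tau> \<noteq> - \<rho>"
  shows "(cmod (wave_kernel t \<tau> \<rho>))\<^sup>2 \<le> (5 * t ^ 4 + 3 * (1 + t)\<^sup>2) / (1 + \<tau>\<^sup>2)"
proof (cases "\<bar>\<tau>\<bar> \<le> 2")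
  case True
  then have "\<bar>\<tau>\<bar> \<le> \<bar>2\<bar>" by simp
  then have "\<tau>\<^sup>2 \<le> 2\<^sup>2" unfolding abs_le_square_iff .
  have "(cmod (wave_kernel t \<tau> \<rho>))\<^sup>2 \<le> (t\<^sup>2)\<^sup>2"
    using assms by (intro power_mono wave_kernel_le_t_square) auto
  then have "(cmod (wave_kernel t \<tau> \<rho>))\<^sup>2 * (1 + \<tau>\<^sup>2) \<le> t ^ 4 * 5"
    using \<open>\<tau>\<^sup>2 \<le> 2\<^sup>2\<close> by (intro mult_mono) (auto simp: power_mult[symmetric])
  also have "\<dots> \<le> 5 * t ^ 4 + 3 * (1 + t)\<^sup>2" by simp
  finally show ?thesis by (simp add: pos_le_divide_eq add_pos_nonneg)
next
  case False
  then have ta: "2 < \<bar>\<tau>\<bar>" by simp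
  then have "\<bar>2\<bar> \<le> \<bar>\<tau>\<bar>" by simp
  then have t2: "4 \<le> \<tau>\<^sup>2" unfolding abs_le_square_iff by simp
  have r2: "\<rho>\<^sup>2 \<le> 1" using assms by (simp add: power_le_one)
  have nz: "\<tau> + \<rho> \<noteq> 0" "\<tau> - \<rho> \<noteq> 0" "\<tau>\<^sup>2 - \<rho>\<^sup>2 \<noteq> 0" using assms t2 r2 by auto
  have nz': "complex_of_real \<tau> + complex_of_real \<rho> \<noteq> 0" "complex_of_real \<tau> - complex_of_real \<rho> \<noteq> 0"
    using nz unfolding of_real_add[symmetric] of_real_diff[symmetric] of_real_eq_0_iff by auto
  define n where "n = complex_of_real (cos (t * \<rho>)) - cis (- (t * \<tau>)) - \<i> * complex_of_real (\<tau> * sin (t * \<rho>) / \<rho>)"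
  have c: "cis (t * \<rho>) = cos (t * \<rho>) + \<i> * sin (t * \<rho>)" "cis (- (t * \<rho>)) = cos (t * \<rho>) - \<i> * sin (t * \<rho>)"
    by (simp_all add: complex_eq_iff)
  \<comment> \<open>Over the common denominator the sines combine to \<tau> sin(t\<rho>)/\<rho>,
    which is at most |\<tau>| t in absolute value, so the singularity in \<rho> disappears.\<close>
  have k: "wave_kernel t \<tau> \<rho> = n / complex_of_real (\<tau>\<^sup>2 - \<rho>\<^sup>2)"
  proof -
    have "complex_of_real (\<tau>\<^sup>2 - \<rho>\<^sup>2) = (complex_of_real \<tau> + complex_of_real \<rho>) * (complex_of_real \<tau> - complex_of_real \<rho>)"
      by (simp add: power2_eq_square algebra_simps)
    then show ?thesis
      unfolding wave_kernel_def n_def c using nz' assms(2)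
      by (simp add: divide_simps) (simp add: algebra_simps)
  qed
  have "cmod n \<le> \<bar>cos (t * \<rho>)\<bar> + 1 + \<bar>\<tau> * sin (t * \<rho>) / \<rho>\<bar>"
    unfolding n_def
    by (rule order.trans[OF norm_triangle_ineq4], intro add_mono, rule order.trans[OF norm_triangle_ineq4])
       (simp_all add: norm_mult norm_divide abs_mult)
  also have "\<bar>\<tau> * sin (t * \<rho>) / \<rho>\<bar> \<le> \<bar>\<tau>\<bar> * t"
  proof -
    have "\<bar>sin (t * \<rho>)\<bar> \<le> t * \<rho>" using abs_sin_x_le_abs_x[of "t * \<rho>"] assms by simp
    then show ?thesis using assms by (simp add: abs_mult divide_simps mult_left_mono mult.assoc)
  qed
  also have "\<bar>cos (t * \<rho>)\<bar> + 1 + \<bar>\<tau>\<bar> * t \<le> \<bar>\<tau>\<bar> * (1 + t)"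
  proof -
    have "\<bar>cos (t * \<rho>)\<bar> \<le> 1" by simp
    then show ?thesis using ta by (simp only: distrib_left mult_1_right)
  qed
  finally have "(cmod n)\<^sup>2 \<le> (\<bar>\<tau>\<bar> * (1 + t))\<^sup>2" by (intro power_mono) auto
  then have n2: "(cmod n)\<^sup>2 \<le> \<tau>\<^sup>2 * (1 + t)\<^sup>2" by (simp add: power_mult_distrib)
  have poly: "\<tau>\<^sup>2 * (1 + \<tau>\<^sup>2) \<le> 3 * (\<tau>\<^sup>2 - \<rho>\<^sup>2)\<^sup>2"
  proof -
    \<comment> \<open>With y \<ge> 0 the difference of the two sides below is 2y^2 + 9y + 7, whose
      coefficients are all positive.\<close>
    define y where "y = \<tau>\<^sup>2 - 4"
    have "(\<tau>\<^sup>2 - 1)\<^sup>2 \<le> (\<tau>\<^sup>2 - \<rho>\<^sup>2)\<^sup>2" using t2 r2 by (intro power_mono) auto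
    moreover have "(y + 4) * (1 + (y + 4)) \<le> 3 * (y + 4 - 1)\<^sup>2"
    proof -
      have "0 \<le> y" using t2 by (simp add: y_def)
      then show ?thesis using mult_nonneg_nonneg[of y y] by (simp add: power2_eq_square algebra_simps)
    qed
    ultimately show ?thesis by (simp add: y_def)
  qed
  have "(cmod (wave_kernel t \<tau> \<rho>))\<^sup>2 = (cmod n)\<^sup>2 / (\<tau>\<^sup>2 - \<rho>\<^sup>2)\<^sup>2"
    unfolding k norm_divide power_divide norm_of_real by simp
  also have "\<dots> \<le> \<tau>\<^sup>2 * (1 + t)\<^sup>2 / (\<tau>\<^sup>2 - \<rho>\<^sup>2)\<^sup>2"
    using n2 by (intro divide_right_mono) auto
  also have "\<dots> \<le> 3 * (1 + t)\<^sup>2 / (1 + \<tau>\<^sup>2)"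
  proof -
    have "(1 + t)\<^sup>2 * (\<tau>\<^sup>2 * (1 + \<tau>\<^sup>2)) \<le> (1 + t)\<^sup>2 * (3 * (\<tau>\<^sup>2 - \<rho>\<^sup>2)\<^sup>2)"
      using poly by (intro mult_left_mono) auto
    moreover have "0 < (\<tau>\<^sup>2 - \<rho>\<^sup>2)\<^sup>2" "0 < 1 + \<tau>\<^sup>2" using nz(3) by (auto simp: add_pos_nonneg)
    ultimately show ?thesis by (simp add: divide_le_eq pos_le_divide_eq ac_simps)
  qed
  also have "\<dots> \<le> (5 * t ^ 4 + 3 * (1 + t)\<^sup>2) / (1 + \<tau>\<^sup>2)"
    by (intro divide_right_mono) (auto intro: add_nonneg_nonneg)
  finally show ?thesis .
qed

text \<open>Close to \<tau> = \<rho> the quotient \<open>B\<close> is nearly a derivative of size t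
  and is at least t/2. The condition 8/t \<le> \<rho> keeps the other quotient \<open>A\<close>
  below t/4, so it cannot cancel \<open>B\<close>.\<close>

lemma wave_kernel_ge_resonant:
  assumes "0 < t" "8 / t \<le> \<rho>" "\<rho> < \<tau>" "\<tau> \<le> \<rho> + 1 / t"
  shows "t / (8 * \<rho>) \<le> cmod (wave_kernel t \<tau> \<rho>)"
proof -
  define w where "w = t * (\<tau> - \<rho>)"
  have "8 \<le> \<rho> * t" using assms by (simp add: field_simps)
  have \<rho>: "0 < \<rho>" using assms by (smt (verit) divide_pos_pos)
  have w: "0 < w" "w \<le> 1" using assms by (auto simp: w_def field_simps)
  define A where "A = (cis (- (t * \<tau>)) - cis (t * \<rho>)) / complex_of_real (\<tau> + \<rho>)"
  define B where "B = (cis (- (t * \<tau>)) - cis (- (t * \<rho>))) / complex_of_real (\<tau> - \<rho>)"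
  have "w / 2 \<le> w - w\<^sup>2 / 2" using w by (simp add: power2_eq_square)
  also have "\<dots> \<le> cmod (\<i> * complex_of_real w) - cmod (iexp w - (1 + \<i> * complex_of_real w))"
    using iexp_approx1[of w 1] w by (simp add: norm_mult power2_eq_square)
  also have "\<dots> \<le> cmod (iexp w - 1)"
    using norm_triangle_ineq2[of "\<i> * complex_of_real w" "- (iexp w - (1 + \<i> * complex_of_real w))"]
    by (simp only: norm_minus_cancel) simp
  also have "iexp w - 1 = - cis (t * \<tau>) * (cis (- (t * \<tau>)) - cis (- (t * \<rho>)))"
    unfolding cis_conv_exp[symmetric] by (simp add: right_diff_distrib cis_mult w_def)
  finally have "w / 2 \<le> cmod (cis (- (t * \<tau>)) - cis (- (t * \<rho>)))"
    by (simp add: norm_mult)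
  then have B: "t / 2 \<le> cmod B"
    using assms by (simp add: B_def norm_divide w_def pos_le_divide_eq of_real_diff[symmetric] del: of_real_diff)
  have "cmod (cis (- (t * \<tau>)) - cis (t * \<rho>)) \<le> 2"
    using norm_triangle_ineq4[of "cis (- (t * \<tau>))" "cis (t * \<rho>)"] by simp
  then have "cmod A \<le> 2 / (\<tau> + \<rho>)"
    using assms \<rho> by (simp add: A_def norm_divide divide_right_mono of_real_add[symmetric] del: of_real_add)
  also have "\<dots> \<le> 2 / (2 * \<rho>)" using assms \<rho> by (intro divide_left_mono) auto
  also have "\<dots> \<le> t / 4" using \<open>8 \<le> \<rho> * t\<close> \<rho> by (simp add: field_simps)
  finally have "t / 4 \<le> cmod B - cmod A" using B by simp
  also have "\<dots> \<le> cmod (A - B)" using norm_triangle_ineq2[of B A] by (simp add: norm_minus_commute)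
  finally have "t / 4 / (2 * \<rho>) \<le> cmod (A - B) / (2 * \<rho>)" using \<rho> by (intro divide_right_mono) auto
  also have "cmod (A - B) / (2 * \<rho>) = cmod (wave_kernel t \<tau> \<rho>)"
    using \<rho> by (simp add: wave_kernel_def A_def B_def norm_divide norm_mult)
  finally show ?thesis by simp
qed

lemma measurable_norm_powr_cball:
  fixes \<gamma> a :: real
  shows "(\<lambda>x. ennreal (norm x powr \<gamma>) * indicator (cball 0 a) x) \<in> borel_measurable (lborel :: 'a::euclidean_space measure)"
  by (intro borel_measurable_times_ennreal borel_measurable_indicator) auto

text \<open>For large \<rho> the mass sits near the peaks: the kernel contributes \<rho>^(-2) and
  the weight at |\<tau>| = \<rho> contributes \<rho>^(-\<kappa>). Here \<kappa> will be 2H -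
  1.\<close>

lemma wave_kernel_nn_integral:
  assumes "0 \<le> t" "0 \<le> \<kappa>" "\<kappa> < 1"
  shows "\<exists>A\<ge>0. \<forall>\<rho>>0.
    (\<integral>\<^sup>+\<tau>. ennreal ((cmod (wave_kernel t \<tau> \<rho>))\<^sup>2 * \<bar>\<tau>\<bar> powr - \<kappa>) \<partial>lborel)
      \<le> ennreal (A * (if \<rho> \<le> 1 then 1 else \<rho> powr (- 2 - \<kappa>)))"
proof -
  obtain C where C: "0 \<le> C" "\<And>a. 0 < a \<Longrightarrow>
      (\<integral>\<^sup>+x. ennreal (\<bar>x\<bar> powr - \<kappa>) * indicator (cball 0 a) x \<partial>lborel) \<le> ennreal (C * a powr (1 - \<kappa>))"
    using nn_integral_norm_powr_cball[where 'a = real, of \<kappa>] assms by auto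
  obtain P where P: "0 \<le> P" "\<And>a. (\<integral>\<^sup>+\<tau>. ennreal (1 / (1 + (\<tau> - a)\<^sup>2)) \<partial>lborel) = ennreal P"
    using nn_integral_inverse_1_plus_square by blast
  define X where "X = 5 * t ^ 4 + 3 * (1 + t)\<^sup>2"
  define Y where "Y = t\<^sup>2 + 4"
  have XY: "0 \<le> X" "0 \<le> Y" using assms by (auto simp: X_def Y_def)
  define A where "A = max (X * (C + P)) (Y * (4 * P + 8 * C))"
  let ?w = "\<lambda>\<rho> \<tau>. (cmod (wave_kernel t \<tau> \<rho>))\<^sup>2 * \<bar>\<tau>\<bar> powr - \<kappa>"
  show ?thesis
  proof (intro exI[of _ A] conjI allI impI)
    show "0 \<le> A" using XY C P by (simp add: A_def le_max_iff_disj)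
    fix \<rho> :: real assume \<rho>: "0 < \<rho>"
    show "(\<integral>\<^sup>+\<tau>. ennreal (?w \<rho> \<tau>) \<partial>lborel) \<le> ennreal (A * (if \<rho> \<le> 1 then 1 else \<rho> powr (- 2 - \<kappa>)))"
    proof (cases "\<rho> \<le> 1")
      case True
      have pw: "?w \<rho> \<tau> \<le> X * (\<bar>\<tau>\<bar> powr - \<kappa> * indicator (cball 0 1) \<tau>) + X * (1 / (1 + (\<tau> - 0)\<^sup>2))"
        if "\<tau> \<noteq> \<rho>" "\<tau> \<noteq> - \<rho>" for \<tau>
      proof -
        have "?w \<rho> \<tau> \<le> X / (1 + \<tau>\<^sup>2) * \<bar>\<tau>\<bar> powr - \<kappa>"
          unfolding X_def using wave_kernel_le_low[OF assms(1) \<rho> True that] by (rule mult_right_mono) simp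
        also have "\<dots> = X * (\<bar>\<tau>\<bar> powr - \<kappa> / (1 + \<tau>\<^sup>2))" by simp
        also have "\<bar>\<tau>\<bar> powr - \<kappa> / (1 + \<tau>\<^sup>2) \<le> \<bar>\<tau>\<bar> powr - \<kappa> * indicator (cball 0 1) \<tau> + 1 / (1 + (\<tau> - 0)\<^sup>2)"
        proof (cases "\<bar>\<tau>\<bar> \<le> 1")
          case True
          have "\<bar>\<tau>\<bar> powr - \<kappa> / (1 + \<tau>\<^sup>2) \<le> \<bar>\<tau>\<bar> powr - \<kappa> / 1"
            by (intro divide_left_mono) (auto simp: add_pos_nonneg)
          moreover have "0 \<le> 1 / (1 + \<tau>\<^sup>2)" by simp
          moreover have "indicator (cball 0 1) \<tau> = (1 :: real)" using True by simp
          ultimately show ?thesis by (simp only: diff_0_right div_by_1 mult_1_right)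
        next
          case False
          then have "\<bar>\<tau>\<bar> powr - \<kappa> \<le> 1" using assms powr_mono2'[of "- \<kappa>" 1 "\<bar>\<tau>\<bar>"] by simp
          then show ?thesis using False by (simp add: divide_right_mono)
        qed
        finally show ?thesis using XY by (simp add: distrib_left mult_left_mono)
      qed
      \<comment> \<open>The resonant values, where division by zero makes the kernel meaningless,
        form a null set.\<close>
      have "AE \<tau> in lborel. \<tau> \<noteq> \<rho> \<and> \<tau> \<noteq> - \<rho>"
        using AE_lborel_singleton[of \<rho>] AE_lborel_singleton[of "- \<rho>"] by eventually_elim simp
      then have "(\<integral>\<^sup>+\<tau>. ennreal (?w \<rho> \<tau>) \<partial>lborel) \<le> (\<integral>\<^sup>+\<tau>. ennreal X * (ennreal (\<bar>\<tau>\<bar> powr - \<kappa>) * indicator (cball 0 1) \<tau>)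
         + ennreal X * ennreal (1 / (1 + (\<tau> - 0)\<^sup>2)) \<partial>lborel)"
      proof (intro nn_integral_mono_AE, eventually_elim)
        fix \<tau> assume "\<tau> \<noteq> \<rho> \<and> \<tau> \<noteq> - \<rho>"
        then have "ennreal (?w \<rho> \<tau>) \<le> ennreal (X * (\<bar>\<tau>\<bar> powr - \<kappa> * indicator (cball 0 1) \<tau>) + X * (1 / (1 + (\<tau> - 0)\<^sup>2)))"
          by (intro ennreal_leI pw) auto
        also have "\<dots> = ennreal X * (ennreal (\<bar>\<tau>\<bar> powr - \<kappa>) * indicator (cball 0 1) \<tau>) + ennreal X * ennreal (1 / (1 + (\<tau> - 0)\<^sup>2))"
        proof -
          have e: "ennreal (X * (p * indicator S \<tau>) + X * v) = ennreal X * (ennreal p * indicator S \<tau>) + ennreal X * ennreal v"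
            if "0 \<le> v" "0 \<le> p" for v p S
            using XY that by (simp add: ennreal_plus ennreal_mult ennreal_indicator)
          show ?thesis by (rule e) simp_all
        qed
        finally show "ennreal (?w \<rho> \<tau>) \<le> \<dots>" .
      qed
      also have "\<dots> = ennreal X * (\<integral>\<^sup>+\<tau>. ennreal (\<bar>\<tau>\<bar> powr - \<kappa>) * indicator (cball 0 1) \<tau> \<partial>lborel)
          + ennreal X * (\<integral>\<^sup>+\<tau>. ennreal (1 / (1 + (\<tau> - 0)\<^sup>2)) \<partial>lborel)"
        using measurable_norm_powr_cball[where 'a = real, of "- \<kappa>" 1]
        by (subst nn_integral_add) (simp_all add: nn_integral_cmult)
      also have "\<dots> \<le> ennreal X * ennreal C + ennreal X * ennreal P"
        using C(2)[of 1] P(2)[of 0] by (intro add_mono mult_left_mono) auto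
      also have "\<dots> = ennreal (X * (C + P))"
        using XY C P by (simp add: ennreal_mult[symmetric] distrib_left)
      also have "\<dots> \<le> ennreal A" by (intro ennreal_leI) (simp add: A_def)
      finally show ?thesis using True by simp
    next
      case False
      define a where "a = Y / \<rho>\<^sup>2 * (2 * \<rho> powr - \<kappa>)"
      define b where "b = Y / \<rho>\<^sup>2 * (8 / \<rho>\<^sup>2)"
      have ab: "0 \<le> a" "0 \<le> b" using XY by (auto simp: a_def b_def)
      \<comment> \<open>The singularity of the weight at 0 is separated from the peak at
        \<open>s\<close>. If |\<tau>| \<ge> \<rho>/2, the weight is at most 2 \<rho>^(-\<kappa>);
        otherwise the distance to \<open>s\<close> is at least \<rho>/2, and the integrable
        singularity on the ball of radius \<rho> carries the factor 4/\<rho>^2.\<close>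
      have pw1: "\<bar>\<tau>\<bar> powr - \<kappa> * (1 / (1 + (\<tau> - s)\<^sup>2))
         \<le> 2 * \<rho> powr - \<kappa> * (1 / (1 + (\<tau> - s)\<^sup>2)) + 4 / \<rho>\<^sup>2 * (\<bar>\<tau>\<bar> powr - \<kappa> * indicator (cball 0 \<rho>) \<tau>)"
        if "\<bar>s\<bar> = \<rho>" for s \<tau>
      proof (cases "\<rho> / 2 \<le> \<bar>\<tau>\<bar>")
        case True
        have "\<bar>\<tau>\<bar> powr - \<kappa> \<le> (\<rho> / 2) powr - \<kappa>" using True \<rho> assms by (intro powr_mono2') auto
        also have "\<dots> = 2 powr \<kappa> * \<rho> powr - \<kappa>"
          using \<rho> by (simp add: powr_divide powr_minus_divide)
        also have "\<dots> \<le> 2 powr 1 * \<rho> powr - \<kappa>" using assms by (intro mult_right_mono powr_mono) auto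
        finally have "\<bar>\<tau>\<bar> powr - \<kappa> * (1 / (1 + (\<tau> - s)\<^sup>2)) \<le> 2 * \<rho> powr - \<kappa> * (1 / (1 + (\<tau> - s)\<^sup>2))"
          by (intro mult_right_mono) auto
        moreover have "0 \<le> 4 / \<rho>\<^sup>2 * (\<bar>\<tau>\<bar> powr - \<kappa> * indicator (cball 0 \<rho>) \<tau>)" by simp
        ultimately show ?thesis by linarith
      next
        case False
        have "\<bar>\<rho> / 2\<bar> \<le> \<bar>\<tau> - s\<bar>" using False that by linarith
        then have "(\<rho> / 2)\<^sup>2 \<le> (\<tau> - s)\<^sup>2" unfolding abs_le_square_iff .
        then have "1 / (1 + (\<tau> - s)\<^sup>2) \<le> 1 / (\<rho> / 2)\<^sup>2" using \<rho> by (intro divide_left_mono) (auto simp: add_pos_nonneg)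
        then have "\<bar>\<tau>\<bar> powr - \<kappa> * (1 / (1 + (\<tau> - s)\<^sup>2)) \<le> \<bar>\<tau>\<bar> powr - \<kappa> * (1 / (\<rho> / 2)\<^sup>2)"
          by (rule mult_left_mono) simp
        also have "\<dots> = 4 / \<rho>\<^sup>2 * (\<bar>\<tau>\<bar> powr - \<kappa> * indicator (cball 0 \<rho>) \<tau>)"
          using False \<rho> by (simp add: power_divide)
        finally have "\<bar>\<tau>\<bar> powr - \<kappa> * (1 / (1 + (\<tau> - s)\<^sup>2)) \<le> 4 / \<rho>\<^sup>2 * (\<bar>\<tau>\<bar> powr - \<kappa> * indicator (cball 0 \<rho>) \<tau>)" .
        moreover have "0 \<le> 2 * \<rho> powr - \<kappa> * (1 / (1 + (\<tau> - s)\<^sup>2))" by simp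
        ultimately show ?thesis by linarith
      qed
      have pw: "?w \<rho> \<tau> \<le> a * (1 / (1 + (\<tau> - (- \<rho>))\<^sup>2)) + a * (1 / (1 + (\<tau> - \<rho>)\<^sup>2))
          + b * (\<bar>\<tau>\<bar> powr - \<kappa> * indicator (cball 0 \<rho>) \<tau>)" for \<tau>
      proof -
        have "?w \<rho> \<tau> \<le> Y / \<rho>\<^sup>2 * (1 / (1 + (\<tau> - (- \<rho>))\<^sup>2) + 1 / (1 + (\<tau> - \<rho>)\<^sup>2)) * \<bar>\<tau>\<bar> powr - \<kappa>"
          unfolding Y_def using wave_kernel_le_high[OF assms(1) \<rho>] by (rule mult_right_mono) simp
        also have "\<dots> = Y / \<rho>\<^sup>2 * (\<bar>\<tau>\<bar> powr - \<kappa> * (1 / (1 + (\<tau> - (- \<rho>))\<^sup>2)) + \<bar>\<tau>\<bar> powr - \<kappa> * (1 / (1 + (\<tau> - \<rho>)\<^sup>2)))"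
          by (simp only: algebra_simps)
        also have "\<dots> \<le> Y / \<rho>\<^sup>2 * ((2 * \<rho> powr - \<kappa> * (1 / (1 + (\<tau> - (- \<rho>))\<^sup>2)) + 4 / \<rho>\<^sup>2 * (\<bar>\<tau>\<bar> powr - \<kappa> * indicator (cball 0 \<rho>) \<tau>))
            + (2 * \<rho> powr - \<kappa> * (1 / (1 + (\<tau> - \<rho>)\<^sup>2)) + 4 / \<rho>\<^sup>2 * (\<bar>\<tau>\<bar> powr - \<kappa> * indicator (cball 0 \<rho>) \<tau>)))"
          using XY \<rho> by (intro mult_left_mono add_mono pw1) auto
        also have "\<dots> = a * (1 / (1 + (\<tau> - (- \<rho>))\<^sup>2)) + a * (1 / (1 + (\<tau> - \<rho>)\<^sup>2))
          + b * (\<bar>\<tau>\<bar> powr - \<kappa> * indicator (cball 0 \<rho>) \<tau>)"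
        proof -
          have "y * ((2 * p * u + 4 / q * v) + (2 * p * w + 4 / q * v))
             = (y * (2 * p)) * u + (y * (2 * p)) * w + (y * (8 / q)) * v" for y p u q v w :: real
            by (simp add: algebra_simps add_divide_distrib[symmetric])
          then show ?thesis unfolding a_def b_def .
        qed
        finally show ?thesis .
      qed
      have "(\<integral>\<^sup>+\<tau>. ennreal (?w \<rho> \<tau>) \<partial>lborel) \<le> (\<integral>\<^sup>+\<tau>. ennreal a * ennreal (1 / (1 + (\<tau> - (- \<rho>))\<^sup>2))
          + ennreal a * ennreal (1 / (1 + (\<tau> - \<rho>)\<^sup>2))
          + ennreal b * (ennreal (\<bar>\<tau>\<bar> powr - \<kappa>) * indicator (cball 0 \<rho>) \<tau>) \<partial>lborel)"
      proof (rule nn_integral_mono)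
        fix \<tau>
        have "ennreal (?w \<rho> \<tau>) \<le> ennreal (a * (1 / (1 + (\<tau> - (- \<rho>))\<^sup>2)) + a * (1 / (1 + (\<tau> - \<rho>)\<^sup>2))
          + b * (\<bar>\<tau>\<bar> powr - \<kappa> * indicator (cball 0 \<rho>) \<tau>))"
          by (intro ennreal_leI pw)
        also have "\<dots> = ennreal a * ennreal (1 / (1 + (\<tau> - (- \<rho>))\<^sup>2)) + ennreal a * ennreal (1 / (1 + (\<tau> - \<rho>)\<^sup>2))
          + ennreal b * (ennreal (\<bar>\<tau>\<bar> powr - \<kappa>) * indicator (cball 0 \<rho>) \<tau>)"
        proof -
          have e: "ennreal (a * u + a * v + b * (p * indicator S \<tau>)) = ennreal a * ennreal u + ennreal a * ennreal v
              + ennreal b * (ennreal p * indicator S \<tau>)" if "0 \<le> u" "0 \<le> v" "0 \<le> p" for u v p S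
            using ab that by (simp add: ennreal_plus ennreal_mult ennreal_indicator)
          show ?thesis by (rule e) simp_all
        qed
        finally show "ennreal (?w \<rho> \<tau>) \<le> \<dots>" .
      qed
      also have "\<dots> = ennreal a * (\<integral>\<^sup>+\<tau>. ennreal (1 / (1 + (\<tau> - (- \<rho>))\<^sup>2)) \<partial>lborel)
          + ennreal a * (\<integral>\<^sup>+\<tau>. ennreal (1 / (1 + (\<tau> - \<rho>)\<^sup>2)) \<partial>lborel)
          + ennreal b * (\<integral>\<^sup>+\<tau>. ennreal (\<bar>\<tau>\<bar> powr - \<kappa>) * indicator (cball 0 \<rho>) \<tau> \<partial>lborel)"
        using measurable_norm_powr_cball[where 'a = real, of "- \<kappa>" \<rho>]
        by (subst nn_integral_add, simp, simp, subst nn_integral_add) (simp_all add: nn_integral_cmult)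
      also have "\<dots> \<le> ennreal a * ennreal P + ennreal a * ennreal P + ennreal b * ennreal (C * \<rho> powr (1 - \<kappa>))"
        unfolding P(2) using C(2)[OF \<rho>] by (intro add_mono mult_left_mono order.refl) auto
      also have "\<dots> = ennreal (2 * a * P + b * (C * \<rho> powr (1 - \<kappa>)))"
        using ab C P by (simp add: ennreal_mult[symmetric] flip: ennreal_plus)
      also have "\<dots> \<le> ennreal (A * \<rho> powr (- 2 - \<kappa>))"
      proof (rule ennreal_leI)
        have 1: "Y / \<rho>\<^sup>2 * (2 * \<rho> powr - \<kappa>) = 2 * Y * \<rho> powr (- 2 - \<kappa>)"
          using \<rho> by (simp add: powr_diff powr_minus_divide powr_numeral)
        \<comment> \<open>The singular part is smaller than the peak part by the factor 1/\<rho>,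
          which is at most 1 in this case.\<close>
        have "Y / \<rho>\<^sup>2 * (8 / \<rho>\<^sup>2) * (C * \<rho> powr (1 - \<kappa>)) = 8 * Y * C * (\<rho> powr (- 2 - \<kappa>) * (1 / \<rho>))"
          using \<rho> by (simp add: powr_diff powr_minus_divide powr_numeral power2_eq_square ac_simps)
        also have "\<dots> \<le> 8 * Y * C * (\<rho> powr (- 2 - \<kappa>) * 1)"
          using False XY C by (intro mult_left_mono) auto
        finally have "2 * a * P + b * (C * \<rho> powr (1 - \<kappa>)) \<le> (Y * (4 * P + 8 * C)) * \<rho> powr (- 2 - \<kappa>)"
          unfolding a_def b_def 1 by (simp add: algebra_simps)
        also have "\<dots> \<le> A * \<rho> powr (- 2 - \<kappa>)" by (intro mult_right_mono) (auto simp: A_def)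
        finally show "2 * a * P + b * (C * \<rho> powr (1 - \<kappa>)) \<le> A * \<rho> powr (- 2 - \<kappa>)" .
      qed
      finally show ?thesis using False by simp
    qed
  qed
qed

section \<open>The equal-time covariance as a spectral integral\<close>

lemma measurable_cis [measurable]: "cis \<in> borel_measurable borel"
  by (intro borel_measurable_continuous_onI continuous_on_cis continuous_on_id)

lemma measurable_wave_kernel [measurable]:
  "(\<lambda>p. wave_kernel t (fst p) (norm (snd p))) \<in> borel_measurable (lborel \<Otimes>\<^sub>M (lborel :: (real^'n) measure))"
  unfolding wave_kernel_def by measurable

text \<open>For fixed t this is, up to the factor cH, the spectral density on the pairs (\<tau>,
  \<xi>) of the spatially stationary field u(t, .).\<close>

definition wave_density :: "real \<Rightarrow> (real^'n \<Rightarrow> real) \<Rightarrow> real \<Rightarrow> real \<times> (real^'n) \<Rightarrow> real" where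
  "wave_density H h t p = (cmod (wave_kernel t (fst p) (norm (snd p))))\<^sup>2 * (\<bar>fst p\<bar> powr (1 - 2 * H) * h (snd p))"

lemma wave_density_nonneg: "(\<And>\<xi>. 0 \<le> h \<xi>) \<Longrightarrow> 0 \<le> wave_density H h t p"
  by (simp add: wave_density_def)

lemma measurable_wave_density [measurable]:
  fixes h :: "real^'n \<Rightarrow> real"
  assumes [measurable]: "h \<in> borel_measurable lborel"
  shows "wave_density H h t \<in> borel_measurable (lborel \<Otimes>\<^sub>M lborel)"
  unfolding wave_density_def by measurable

text \<open>After integration in \<tau> the integrand is at most of order |\<xi>|^(-\<beta>) near 0,
  integrable as \<beta> < N, and |\<xi>|^(-(\<beta>+2H+1)) at infinity, integrable as N - 2H - 1 <
  \<beta>.\<close>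

lemma integrable_wave_density:
  fixes h :: "real^'n \<Rightarrow> real"
  assumes H: "1/2 \<le> H" "H < 1"
    and beta: "0 < \<beta>" "\<beta> < real CARD('n)" "real CARD('n) - 2 * H - 1 < \<beta>"
    and h [measurable]: "h \<in> borel_measurable lborel" and h_nonneg: "\<And>\<xi>. 0 \<le> h \<xi>"
    and h_le: "\<And>\<xi>. \<xi> \<noteq> 0 \<Longrightarrow> h \<xi> \<le> c2 * norm \<xi> powr - \<beta>"
    and t: "0 \<le> t"
  shows "integrable (lborel \<Otimes>\<^sub>M lborel) (wave_density H h t)"
proof (rule integrableI_nonneg)
  show "AE p in lborel \<Otimes>\<^sub>M lborel. 0 \<le> wave_density H h t p"
    using h_nonneg by (intro AE_I2 wave_density_nonneg)
  define \<kappa> where "\<kappa> = 2 * H - 1"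
  have \<kappa>: "0 \<le> \<kappa>" "\<kappa> < 1" using H by (auto simp: \<kappa>_def)
  obtain A where A: "0 \<le> A" "\<And>\<rho>. 0 < \<rho> \<Longrightarrow>
    (\<integral>\<^sup>+\<tau>. ennreal ((cmod (wave_kernel t \<tau> \<rho>))\<^sup>2 * \<bar>\<tau>\<bar> powr - \<kappa>) \<partial>lborel)
      \<le> ennreal (A * (if \<rho> \<le> 1 then 1 else \<rho> powr (- 2 - \<kappa>)))"
    using wave_kernel_nn_integral[OF t \<kappa>] by blast
  \<comment> \<open>Read off from the upper bound for \<open>h\<close> at a unit vector.\<close>
  have c2: "0 \<le> c2"
    using h_le[of "axis undefined 1"] h_nonneg[of "axis undefined 1"] by (simp add: norm_axis_1 axis_eq_0_iff)
  let ?B1 = "\<lambda>\<xi>::real^'n. ennreal (norm \<xi> powr - \<beta>) * indicator (cball 0 1) \<xi>"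
  let ?B2 = "\<lambda>\<xi>::real^'n. ennreal (norm \<xi> powr - (\<beta> + 2 + \<kappa>)) * indicator {x. 1 \<le> norm x} \<xi>"
  have inner: "(\<integral>\<^sup>+\<tau>. ennreal (wave_density H h t (\<tau>, \<xi>)) \<partial>lborel) \<le> ennreal (c2 * A) * (?B1 \<xi> + ?B2 \<xi>)" if "\<xi> \<noteq> 0" for \<xi>
  proof -
    let ?g = "if norm \<xi> \<le> 1 then 1 else norm \<xi> powr (- 2 - \<kappa>)"
    have "(\<integral>\<^sup>+\<tau>. ennreal (wave_density H h t (\<tau>, \<xi>)) \<partial>lborel)
      = (\<integral>\<^sup>+\<tau>. ennreal (h \<xi>) * ennreal ((cmod (wave_kernel t \<tau> (norm \<xi>)))\<^sup>2 * \<bar>\<tau>\<bar> powr - \<kappa>) \<partial>lborel)"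
    proof (rule nn_integral_cong)
      fix \<tau>
      have "wave_density H h t (\<tau>, \<xi>) = h \<xi> * ((cmod (wave_kernel t \<tau> (norm \<xi>)))\<^sup>2 * \<bar>\<tau>\<bar> powr - \<kappa>)"
        by (simp add: wave_density_def \<kappa>_def)
      then show "ennreal (wave_density H h t (\<tau>, \<xi>)) = ennreal (h \<xi>) * ennreal ((cmod (wave_kernel t \<tau> (norm \<xi>)))\<^sup>2 * \<bar>\<tau>\<bar> powr - \<kappa>)"
        using h_nonneg[of \<xi>] by (simp only: ennreal_mult')
    qed
    also have "\<dots> = ennreal (h \<xi>) * (\<integral>\<^sup>+\<tau>. ennreal ((cmod (wave_kernel t \<tau> (norm \<xi>)))\<^sup>2 * \<bar>\<tau>\<bar> powr - \<kappa>) \<partial>lborel)"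
      by (rule nn_integral_cmult) (unfold wave_kernel_def, measurable)
    also have "\<dots> \<le> ennreal (c2 * norm \<xi> powr - \<beta>) * ennreal (A * ?g)"
      using that by (intro mult_mono ennreal_leI h_le A(2)) auto
    also have "\<dots> = ennreal (c2 * A) * ennreal (norm \<xi> powr - \<beta> * ?g)"
      using c2 A(1) by (simp add: ennreal_mult[symmetric] ac_simps)
    also have "ennreal (norm \<xi> powr - \<beta> * ?g) \<le> ?B1 \<xi> + ?B2 \<xi>"
    proof (cases "norm \<xi> \<le> 1")
      case False
      have "norm \<xi> powr - \<beta> * norm \<xi> powr (- 2 - \<kappa>) = norm \<xi> powr - (\<beta> + 2 + \<kappa>)"
        by (simp add: powr_add[symmetric] algebra_simps)
      then show ?thesis using False by simp
    qed simp
    finally show ?thesis by (simp add: mult_left_mono)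
  qed
  have "(\<integral>\<^sup>+p. ennreal (wave_density H h t p) \<partial>(lborel \<Otimes>\<^sub>M lborel))
    = (\<integral>\<^sup>+\<xi>. (\<integral>\<^sup>+\<tau>. ennreal (wave_density H h t (\<tau>, \<xi>)) \<partial>lborel) \<partial>lborel)"
    by (rule lborel_pair.nn_integral_snd[symmetric]) measurable
  also have "\<dots> \<le> (\<integral>\<^sup>+\<xi>. ennreal (c2 * A) * (?B1 \<xi> + ?B2 \<xi>) \<partial>lborel)"
  proof (rule nn_integral_mono_AE)
    have "AE \<xi> in lborel. (\<xi> :: real^'n) \<noteq> 0" by (rule AE_lborel_singleton)
    then show "AE \<xi> in lborel. (\<integral>\<^sup>+\<tau>. ennreal (wave_density H h t (\<tau>, \<xi>)) \<partial>lborel) \<le> ennreal (c2 * A) * (?B1 \<xi> + ?B2 \<xi>)"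
      by eventually_elim (rule inner)
  qed
  also have "\<dots> = ennreal (c2 * A) * ((\<integral>\<^sup>+\<xi>. ?B1 \<xi> \<partial>lborel) + (\<integral>\<^sup>+\<xi>. ?B2 \<xi> \<partial>lborel))"
  proof -
    have b1: "?B1 \<in> borel_measurable lborel" by (rule measurable_norm_powr_cball)
    have "{x :: real^'n. 1 \<le> norm x} \<in> sets lborel" by measurable
    then have b2: "?B2 \<in> borel_measurable lborel"
      by (intro borel_measurable_times_ennreal borel_measurable_indicator) auto
    show ?thesis
      by (simp only: nn_integral_cmult[OF borel_measurable_add[OF b1 b2]] nn_integral_add[OF b1 b2])
  qed
  also have "\<dots> < \<infinity>"
  proof -
    have "0 \<le> \<beta>" "\<beta> < DIM(real^'n)" using beta by auto
    from nn_integral_norm_powr_cball[OF this] obtain C where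
      C: "\<And>a. 0 < a \<Longrightarrow> (\<integral>\<^sup>+\<xi>. ennreal (norm \<xi> powr - \<beta>) * indicator (cball 0 a) \<xi> \<partial>(lborel :: (real^'n) measure))
        \<le> ennreal (C * a powr (DIM(real^'n) - \<beta>))" by blast
    have "(\<integral>\<^sup>+\<xi>. ?B1 \<xi> \<partial>lborel) \<le> ennreal (C * 1 powr (DIM(real^'n) - \<beta>))" by (rule C) simp
    then have "(\<integral>\<^sup>+\<xi>. ?B1 \<xi> \<partial>lborel) < \<infinity>" by (rule order.strict_trans1) simp
    moreover have "(\<integral>\<^sup>+\<xi>. ?B2 \<xi> \<partial>lborel) < \<infinity>"
      using nn_integral_norm_powr_outside[where 'a = "real^'n", of "\<beta> + 2 + \<kappa>"] beta
      by (simp add: \<kappa>_def)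
    ultimately show ?thesis by (simp add: ennreal_mult_less_top)
  qed
  finally show "(\<integral>\<^sup>+p. ennreal (wave_density H h t p) \<partial>(lborel \<Otimes>\<^sub>M lborel)) < \<infinity>" .
qed simp

text \<open>At equal times the temporal factors combine to a squared modulus; this positivity is
  what later permits discarding frequencies.\<close>

lemma Fg_times_cnj:
  "Fg t x \<tau> \<xi> * cnj (Fg t y \<tau> \<xi>) * complex_of_real (\<bar>\<tau>\<bar> powr (1 - 2 * H) * h \<xi>)
    = cis (- (x \<bullet> \<xi>)) * cnj (cis (- (y \<bullet> \<xi>))) * wave_density H h t (\<tau>, \<xi>)"
proof -
  have "Fg t x \<tau> \<xi> * cnj (Fg t y \<tau> \<xi>) = cis (- (x \<bullet> \<xi>)) * cnj (cis (- (y \<bullet> \<xi>)))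
      * (wave_kernel t \<tau> (norm \<xi>) * cnj (wave_kernel t \<tau> (norm \<xi>)))"
    by (simp add: Fg_eq ac_simps)
  also have "wave_kernel t \<tau> (norm \<xi>) * cnj (wave_kernel t \<tau> (norm \<xi>)) = (cmod (wave_kernel t \<tau> (norm \<xi>)))\<^sup>2"
    by (rule complex_norm_square[symmetric])
  finally show ?thesis by (simp add: wave_density_def mult.assoc)
qed

text \<open>The integrability of the density passes to every covariance integrand, since the phases
  are unimodular. It justifies replacing the iterated integral by one over the product, where the
  double sum becomes a squared modulus.\<close>

lemma wave_cov_quadratic_form:
  fixes h :: "real^'n \<Rightarrow> real" and y :: "'i \<Rightarrow> real^'n"
  assumes int: "integrable (lborel \<Otimes>\<^sub>M lborel) (wave_density H h t)" and K: "finite K"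
  shows "(\<Sum>k\<in>K. \<Sum>l\<in>K. complex_of_real (z k * z l) * wave_cov cH H h t (y k) t (y l))
    = complex_of_real (cH * (LINT p|(lborel \<Otimes>\<^sub>M lborel).
        (cmod (\<Sum>k\<in>K. z k * cis (- (y k \<bullet> snd p))))\<^sup>2 * wave_density H h t p))"
    (is "?lhs = complex_of_real (cH * (LINT p|?L. ?\<Phi> p))")
    and "integrable (lborel \<Otimes>\<^sub>M lborel)
       (\<lambda>p. (cmod (\<Sum>k\<in>K. z k * cis (- (y k \<bullet> snd p))))\<^sup>2 * wave_density H h t p)"
proof -
  let ?c = "\<lambda>k l p. cis (- (y k \<bullet> snd p)) * cnj (cis (- (y l \<bullet> snd p))) * complex_of_real (wave_density H h t p)"
  have ci: "integrable ?L (?c k l)" for k l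
  proof (rule Bochner_Integration.integrable_bound[OF int])
    show "?c k l \<in> borel_measurable ?L"
      using borel_measurable_integrable[OF int] by (simp add: cis_cnj)
  qed (simp add: norm_mult)
  have cov: "wave_cov cH H h t (y k) t (y l) = complex_of_real cH * (LINT p|?L. ?c k l p)" for k l
    unfolding wave_cov_def Fg_times_cnj using lborel_pair.integral_fst'[OF ci[of k l]] by simp
  have sq: "complex_of_real (?\<Phi> p) = (\<Sum>k\<in>K. \<Sum>l\<in>K. complex_of_real (z k * z l) * ?c k l p)" for p
  proof -
    have "complex_of_real (?\<Phi> p) = (\<Sum>k\<in>K. z k * cis (- (y k \<bullet> snd p))) * cnj (\<Sum>k\<in>K. z k * cis (- (y k \<bullet> snd p)))
      * complex_of_real (wave_density H h t p)"
      by (simp only: of_real_mult complex_norm_square)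
    also have "\<dots> = (\<Sum>k\<in>K. \<Sum>l\<in>K. complex_of_real (z k * z l) * ?c k l p)"
      unfolding cnj_sum sum_product unfolding sum_distrib_right by (intro sum.cong refl) simp
    finally show ?thesis .
  qed
  have \<Phi>i: "integrable ?L (\<lambda>p. complex_of_real (?\<Phi> p))"
    unfolding sq by (intro Bochner_Integration.integrable_sum integrable_mult_right ci)
  then show "integrable ?L ?\<Phi>" by (simp only: complex_of_real_integrable_eq)
  have "complex_of_real (LINT p|?L. ?\<Phi> p) = (LINT p|?L. complex_of_real (?\<Phi> p))"
    by (rule integral_complex_of_real[symmetric])
  also have "\<dots> = (\<Sum>k\<in>K. \<Sum>l\<in>K. complex_of_real (z k * z l) * (LINT p|?L. ?c k l p))"
    unfolding sq by (simp add: Bochner_Integration.integral_sum ci Bochner_Integration.integrable_sum del: of_real_mult)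
  finally show "?lhs = complex_of_real (cH * (LINT p|?L. ?\<Phi> p))"
    by (simp add: cov sum_distrib_left ac_simps)
qed

section \<open>Local nondeterminism along a spatial line\<close>

text \<open>Parseval's identity for frequencies that are multiples of \<delta>. The starting point
  \<open>c\<close> of the period is free so that the interval can be placed away from 0.\<close>

lemma nn_integral_trig_polynomial:
  fixes K :: "nat set" and z :: "nat \<Rightarrow> real"
  assumes K: "finite K" and \<delta>: "0 < \<delta>"
  shows "(\<integral>\<^sup>+s. ennreal ((cmod (\<Sum>k\<in>K. z k * cis (- (real k * \<delta> * s))))\<^sup>2 * indicator {c..c + 2 * pi / \<delta>} s) \<partial>lborel)
    = ennreal (2 * pi / \<delta> * (\<Sum>k\<in>K. (z k)\<^sup>2))"
proof -
  let ?\<Phi> = "\<lambda>s. (cmod (\<Sum>k\<in>K. z k * cis (- (real k * \<delta> * s))))\<^sup>2"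
  let ?I = "{c..c + 2 * pi / \<delta>}"
  have sq: "?\<Phi> s = (\<Sum>k\<in>K. \<Sum>l\<in>K. z k * z l * cos ((real k - real l) * \<delta> * s))" for s
  proof -
    have "complex_of_real (?\<Phi> s) = (\<Sum>k\<in>K. z k * cis (- (real k * \<delta> * s))) * cnj (\<Sum>k\<in>K. z k * cis (- (real k * \<delta> * s)))"
      by (rule complex_norm_square)
    also have "\<dots> = (\<Sum>k\<in>K. \<Sum>l\<in>K. complex_of_real (z k * z l) * cis (- ((real k - real l) * \<delta> * s)))"
      unfolding cnj_sum sum_product
      by (intro sum.cong refl) (simp add: cis_cnj cis_mult algebra_simps)
    finally have "complex_of_real (?\<Phi> s) = \<dots>" .
    then have "Re (complex_of_real (?\<Phi> s)) = Re (\<Sum>k\<in>K. \<Sum>l\<in>K. complex_of_real (z k * z l) * cis (- ((real k - real l) * \<delta> * s)))"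
      by (rule arg_cong)
    then show ?thesis by simp
  qed
  have cos_int: "((\<lambda>s. cos ((real k - real l) * \<delta> * s)) has_integral (if k = l then 2 * pi / \<delta> else 0)) ?I" for k l
  proof (cases "k = l")
    case True
    then show ?thesis using has_integral_const_real[of "1::real" c "c + 2 * pi / \<delta>"] \<delta> by simp
  next
    case False
    define m where "m = real k - real l"
    have m: "m \<noteq> 0" using False by (simp add: m_def)
    have "((\<lambda>s. cos (m * \<delta> * s)) has_integral (sin (m * \<delta> * (c + 2 * pi / \<delta>)) / (m * \<delta>) - sin (m * \<delta> * c) / (m * \<delta>))) ?I"
      using m \<delta> by (intro fundamental_theorem_of_calculus)
        (auto intro!: derivative_eq_intros simp: has_real_derivative_iff_has_vector_derivative[symmetric])
    \<comment> \<open>Crossing one period changes the argument by 2 pi times the integer k -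
      l.\<close>
    moreover have "sin (m * \<delta> * (c + 2 * pi / \<delta>)) = sin (m * \<delta> * c)"
    proof -
      have "m * \<delta> * (c + 2 * pi / \<delta>) = m * \<delta> * c + 2 * pi * of_int (int k - int l)"
        using \<delta> by (simp add: m_def field_simps)
      then show ?thesis by (simp only: sin.plus_of_int sin_add) (simp add: sin_int_2pin cos_int_2pin del: of_int_diff)
    qed
    ultimately show ?thesis using False by (simp add: m_def)
  qed
  have "(?\<Phi> has_integral (\<Sum>k\<in>K. \<Sum>l\<in>K. z k * z l * (if k = l then 2 * pi / \<delta> else 0))) ?I"
    unfolding sq by (intro has_integral_sum K has_integral_mult_right cos_int)
  also have "(\<Sum>k\<in>K. \<Sum>l\<in>K. z k * z l * (if k = l then 2 * pi / \<delta> else 0)) = 2 * pi / \<delta> * (\<Sum>k\<in>K. (z k)\<^sup>2)"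
    using K by (simp add: if_distrib sum.delta sum_distrib_left power2_eq_square ac_simps cong: if_cong)
  finally have "(?\<Phi> has_integral (2 * pi / \<delta> * (\<Sum>k\<in>K. (z k)\<^sup>2))) ?I" .
  then have "((\<lambda>s. if s \<in> ?I then ?\<Phi> s else 0) has_integral (2 * pi / \<delta> * (\<Sum>k\<in>K. (z k)\<^sup>2))) UNIV"
    by (simp only: has_integral_restrict_UNIV)
  also have "(\<lambda>s. if s \<in> ?I then ?\<Phi> s else 0) = (\<lambda>s. ?\<Phi> s * indicator ?I s)"
    by (auto simp: fun_eq_iff)
  finally show ?thesis
  proof (intro nn_integral_has_integral_lborel)
    have "?\<Phi> \<in> borel_measurable borel" by measurable
    then show "(\<lambda>s. ?\<Phi> s * indicator ?I s) \<in> borel_measurable borel"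
      by (rule borel_measurable_times[OF _ borel_measurable_indicator[OF borel_closed[OF closed_atLeastAtMost]]])
  qed simp
qed

text \<open>The integrand depends on one coordinate only, so the integral is a product: Parseval in
  direction \<open>e\<close> and length 1/\<delta> in the others. The start pi/\<delta> of the
  distinguished side keeps the norm of \<xi> at least pi/\<delta> on the box.\<close>

lemma nn_integral_trig_polynomial_box:
  fixes K :: "nat set" and z :: "nat \<Rightarrow> real" and e :: "'a::euclidean_space"
  assumes K: "finite K" and \<delta>: "0 < \<delta>" and e: "e \<in> Basis"
  shows "(\<integral>\<^sup>+\<xi>. ennreal ((cmod (\<Sum>k\<in>K. z k * cis (- (real k * \<delta> * (\<xi> \<bullet> e)))))\<^sup>2 *
        indicator {\<xi>. \<forall>b\<in>Basis. \<xi> \<bullet> b \<in> (if b = e then {pi / \<delta>..pi / \<delta> + 2 * pi / \<delta>} else {0..1 / \<delta>})} \<xi>) \<partial>lborel)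
    = ennreal (2 * pi * \<delta> powr - DIM('a) * (\<Sum>k\<in>K. (z k)\<^sup>2))"
proof -
  let ?\<Phi> = "\<lambda>s. (cmod (\<Sum>k\<in>K. z k * cis (- (real k * \<delta> * s))))\<^sup>2"
  let ?J = "\<lambda>b. if b = e then {pi / \<delta>..pi / \<delta> + 2 * pi / \<delta>} else {0..1 / \<delta>}"
  define f where "f b s = ennreal ((if b = e then ?\<Phi> s else 1) * indicator (?J b) s)" for b s
  have "ennreal (?\<Phi> (\<xi> \<bullet> e) * indicator {\<xi>. \<forall>b\<in>Basis. \<xi> \<bullet> b \<in> ?J b} \<xi>) = (\<Prod>b\<in>Basis. f b (\<xi> \<bullet> b))" for \<xi>
  proof (cases "\<forall>b\<in>Basis. \<xi> \<bullet> b \<in> ?J b")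
    case True
    then have "(\<Prod>b\<in>Basis. f b (\<xi> \<bullet> b)) = (\<Prod>b\<in>Basis. if b = e then ennreal (?\<Phi> (\<xi> \<bullet> e)) else 1)"
      by (intro prod.cong) (auto simp: f_def)
    then show ?thesis using True e by (simp add: prod.delta)
  next
    case False
    then obtain b where "b \<in> Basis" "\<xi> \<bullet> b \<notin> ?J b" by blast
    then have "f b (\<xi> \<bullet> b) = 0" by (simp add: f_def)
    then have "(\<Prod>b\<in>Basis. f b (\<xi> \<bullet> b)) = 0" using \<open>b \<in> Basis\<close> by (intro prod_zero) auto
    moreover have "indicator {\<xi>. \<forall>b\<in>Basis. \<xi> \<bullet> b \<in> ?J b} \<xi> = (0::real)" using False by simp
    ultimately show ?thesis by simp
  qed
  then have "(\<integral>\<^sup>+\<xi>. ennreal (?\<Phi> (\<xi> \<bullet> e) * indicator {\<xi>. \<forall>b\<in>Basis. \<xi> \<bullet> b \<in> ?J b} \<xi>) \<partial>lborel)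
     = (\<integral>\<^sup>+\<xi>. (\<Prod>b\<in>Basis. f b (\<xi> \<bullet> b)) \<partial>(lborel :: 'a measure))" by (simp only:)
  also have "\<dots> = (\<Prod>b\<in>Basis. (\<integral>\<^sup>+s. f b s \<partial>lborel))"
    by (rule nn_integral_lborel_prod) (auto simp: f_def)
  also have "\<dots> = (\<Prod>b\<in>Basis. ennreal (if b = e then 2 * pi / \<delta> * (\<Sum>k\<in>K. (z k)\<^sup>2) else 1 / \<delta>))"
  proof (rule prod.cong[OF refl])
    fix b :: 'a
    show "(\<integral>\<^sup>+s. f b s \<partial>lborel) = ennreal (if b = e then 2 * pi / \<delta> * (\<Sum>k\<in>K. (z k)\<^sup>2) else 1 / \<delta>)"
    proof (cases "b = e")
      case True
      then show ?thesis
        unfolding f_def using nn_integral_trig_polynomial[OF K \<delta>, of z "pi / \<delta>"] by simp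
    next
      case False
      then show ?thesis unfolding f_def using \<delta> by (simp add: ennreal_indicator)
    qed
  qed
  also have "\<dots> = ennreal (\<Prod>b\<in>(Basis::'a set). if b = e then 2 * pi / \<delta> * (\<Sum>k\<in>K. (z k)\<^sup>2) else 1 / \<delta>)"
    using \<delta> by (intro prod_ennreal) (auto intro!: mult_nonneg_nonneg divide_nonneg_nonneg sum_nonneg)
  also have "(\<Prod>b\<in>(Basis::'a set). if b = e then 2 * pi / \<delta> * (\<Sum>k\<in>K. (z k)\<^sup>2) else 1 / \<delta>)
      = 2 * pi / \<delta> * (\<Sum>k\<in>K. (z k)\<^sup>2) * (\<Prod>b\<in>(Basis::'a set) - {e}. 1 / \<delta>)"
  proof -
    have "(\<Prod>b\<in>(Basis::'a set) - {e}. if b = e then 2 * pi / \<delta> * (\<Sum>k\<in>K. (z k)\<^sup>2) else 1 / \<delta>) = (\<Prod>b\<in>(Basis::'a set) - {e}. 1 / \<delta>)"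
      by (rule prod.cong) auto
    then show ?thesis using e by (subst prod.remove[OF _ e]) simp_all
  qed
  also have "\<dots> = 2 * pi * \<delta> powr - DIM('a) * (\<Sum>k\<in>K. (z k)\<^sup>2)"
  proof -
    have "\<delta> powr - DIM('a) = (1 / \<delta>) ^ DIM('a)"
      using \<delta> by (simp add: powr_minus_divide powr_realpow power_divide)
    also have "\<dots> = (1 / \<delta>) * (1 / \<delta>) ^ (DIM('a) - 1)"
      using DIM_positive[where 'a = 'a] by (simp only: power_Suc[symmetric]) simp
    finally show ?thesis using e by (simp add: card_Diff_singleton)
  qed
  finally show ?thesis .
qed

text \<open>Only frequencies \<open>\<xi>\<close> of size comparable to \<open>1/\<delta>\<close> and times frequencies \<open>\<tau>\<close> close to the
  resonance \<open>\<tau> = norm \<xi>\<close> are kept.\<close>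

lemma wave_quadratic_form_ge:
  fixes h :: "real^'n \<Rightarrow> real"
  assumes H: "1/2 \<le> H" and \<beta>: "0 < \<beta>"
    and h [measurable]: "h \<in> borel_measurable lborel" and h_nonneg: "\<And>\<xi>. 0 \<le> h \<xi>"
    and c1: "0 < c1" and h_ge: "\<And>\<xi>. \<xi> \<noteq> 0 \<Longrightarrow> c1 * norm \<xi> powr - \<beta> \<le> h \<xi>"
    and t0: "0 < t0"
  shows "\<exists>c>0. \<forall>t \<delta> K z x. t0 \<le> t \<longrightarrow> 0 < \<delta> \<longrightarrow> \<delta> \<le> t0 / 8 \<longrightarrow> finite K \<longrightarrow>
     integrable (lborel \<Otimes>\<^sub>M lborel) (wave_density H h t) \<longrightarrow>
     c * \<delta> powr (2 * H + 1 + \<beta> - CARD('n)) * (\<Sum>k\<in>K. (z k)\<^sup>2)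
      \<le> (LINT p|(lborel \<Otimes>\<^sub>M lborel).
        (cmod (\<Sum>k\<in>K. complex_of_real (z k) * cis (- ((x + (real k * \<delta>) *\<^sub>R axis i 1) \<bullet> snd p))))\<^sup>2 * wave_density H h t p)"
proof -
  \<comment> \<open>On the frequency box the sum of the absolute coordinates, and hence the norm, is
    at most Q/\<delta>.\<close>
  define Q where "Q = 3 * pi + CARD('n)"
  have Q: "0 < Q" by (simp add: Q_def add_pos_nonneg)
  \<comment> \<open>The constant collects 1/64 from the squared resonance bound, the power of 2 from
    \<tau> \<le> 2\<rho>, the power of \<open>Q\<close> from \<rho> \<le> Q/\<delta>, and 2 pi from
    Parseval. The factor t0 bounds t^2 times the window length 1/t from below.\<close>
  define c where "c = t0 * c1 / 64 * 2 powr (1 - 2 * H) * Q powr - (2 * H + 1 + \<beta>) * (2 * pi)"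
  have "0 < c" using t0 c1 Q by (simp add: c_def)
  moreover have "c * \<delta> powr (2 * H + 1 + \<beta> - CARD('n)) * (\<Sum>k\<in>K. (z k)\<^sup>2)
      \<le> (LINT p|(lborel \<Otimes>\<^sub>M lborel).
        (cmod (\<Sum>k\<in>K. complex_of_real (z k) * cis (- ((x + (real k * \<delta>) *\<^sub>R axis i 1) \<bullet> snd p))))\<^sup>2 * wave_density H h t p)"
    if t: "t0 \<le> t" and \<delta>: "0 < \<delta>" "\<delta> \<le> t0 / 8" and K: "finite K"
     and int: "integrable (lborel \<Otimes>\<^sub>M lborel) (wave_density H h t)"
    for t \<delta> K and z :: "nat \<Rightarrow> real" and x :: "real^'n"
  proof -
    let ?L = "lborel \<Otimes>\<^sub>M (lborel :: (real^'n) measure)"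
    let ?e = "axis i 1 :: real^'n"
    have e: "?e \<in> Basis" by (auto simp: Basis_vec_def)
    have tpos: "0 < t" using t t0 by simp
    let ?P = "\<lambda>\<xi>::real^'n. (cmod (\<Sum>k\<in>K. z k * cis (- (real k * \<delta> * (\<xi> \<bullet> ?e)))))\<^sup>2"
    \<comment> \<open>The base point x contributes a common unimodular factor, so the bound is
      uniform in x.\<close>
    have P: "(cmod (\<Sum>k\<in>K. complex_of_real (z k) * cis (- ((x + (real k * \<delta>) *\<^sub>R ?e) \<bullet> \<xi>))))\<^sup>2 = ?P \<xi>" for \<xi>
    proof -
      have "(\<Sum>k\<in>K. complex_of_real (z k) * cis (- ((x + (real k * \<delta>) *\<^sub>R ?e) \<bullet> \<xi>)))
        = cis (- (x \<bullet> \<xi>)) * (\<Sum>k\<in>K. z k * cis (- (real k * \<delta> * (\<xi> \<bullet> ?e))))"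
        unfolding sum_distrib_left
        by (intro sum.cong refl) (simp add: inner_add_right inner_commute[of _ \<xi>] cis_mult mult.left_commute)
      then show ?thesis by (simp add: norm_mult)
    qed
    define B where "B = {\<xi>::real^'n. \<forall>b\<in>Basis. \<xi> \<bullet> b \<in> (if b = ?e then {pi / \<delta>..pi / \<delta> + 2 * pi / \<delta>} else {0..1 / \<delta>})}"
    have Bm [measurable]: "B \<in> sets borel"
    proof -
      have "B = (\<Inter>b\<in>Basis. (\<lambda>\<xi>. \<xi> \<bullet> b) -` (if b = ?e then {pi / \<delta>..pi / \<delta> + 2 * pi / \<delta>} else {0..1 / \<delta>}))"
        by (auto simp: B_def)
      also have "closed \<dots>" by (intro closed_INT ballI continuous_closed_vimage) auto
      finally show ?thesis by simp
    qed
    \<comment> \<open>A lower bound for the density on the whole retained region. The exponent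
      2H+1+\<beta> is 2 from the squared kernel, 2H-1 from the weight in \<tau> and \<beta> from
      \<open>h\<close>.\<close>
    define g where "g = c1 * t\<^sup>2 / 64 * 2 powr (1 - 2 * H) * (Q / \<delta>) powr - (2 * H + 1 + \<beta>)"
    have g: "0 \<le> g" using c1 by (simp add: g_def)
    have dens: "g \<le> wave_density H h t (\<tau>, \<xi>)"
      if "\<xi> \<in> B" and \<tau>: "norm \<xi> < \<tau>" "\<tau> \<le> norm \<xi> + 1 / t" for \<tau> \<xi>
    proof -
      define \<rho> where "\<rho> = norm \<xi>"
      have coord: "\<xi> \<bullet> b \<in> (if b = ?e then {pi / \<delta>..pi / \<delta> + 2 * pi / \<delta>} else {0..1 / \<delta>})" if "b \<in> Basis" for b
        using \<open>\<xi> \<in> B\<close> that by (simp add: B_def)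
      have "pi / \<delta> \<le> \<xi> \<bullet> ?e" using coord[OF e] by simp
      also have "\<dots> \<le> \<rho>" unfolding \<rho>_def using Basis_le_norm[OF e, of \<xi>] by linarith
      finally have r1: "pi / \<delta> \<le> \<rho>" .
      \<comment> \<open>Here \<delta> \<le> t0/8 ensures that the box lies in the range of
        \<open>wave_kernel_ge_resonant\<close>.\<close>
      have "8 / t \<le> 8 / t0" using t t0 by (intro divide_left_mono) auto
      also have "\<dots> \<le> 1 / \<delta>" using \<delta> t0 by (simp add: field_simps)
      also have "\<dots> \<le> pi / \<delta>" using \<delta> pi_ge_two by (intro divide_right_mono) auto
      finally have r2: "8 / t \<le> \<rho>" using r1 by simp
      have r0: "0 < \<rho>" using r2 tpos by (smt (verit) divide_pos_pos)
      have "\<rho> \<le> (\<Sum>b\<in>Basis. \<bar>\<xi> \<bullet> b\<bar>)" unfolding \<rho>_def by (rule norm_le_l1)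
      also have "\<dots> = \<bar>\<xi> \<bullet> ?e\<bar> + (\<Sum>b\<in>Basis - {?e}. \<bar>\<xi> \<bullet> b\<bar>)"
        by (rule sum.remove) (use e in auto)
      also have "\<dots> \<le> 3 * pi / \<delta> + (\<Sum>b\<in>(Basis :: (real^'n) set) - {?e}. 1 / \<delta>)"
      proof (intro add_mono sum_mono)
        have "0 < pi / \<delta>" using \<delta> by simp
        then show "\<bar>\<xi> \<bullet> ?e\<bar> \<le> 3 * pi / \<delta>" using coord[OF e] by auto
        fix b assume "b \<in> (Basis :: (real^'n) set) - {?e}"
        then show "\<bar>\<xi> \<bullet> b\<bar> \<le> 1 / \<delta>" using coord[of b] by auto
      qed
      also have "\<dots> \<le> 3 * pi / \<delta> + CARD('n) / \<delta>"
        using e \<delta> by (simp add: card_Diff_singleton divide_right_mono)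
      also have "\<dots> = Q / \<delta>" by (simp add: Q_def add_divide_distrib)
      finally have r3: "\<rho> \<le> Q / \<delta>" .
      have "1 / t \<le> 8 / t" using tpos by (simp add: divide_right_mono)
      then have \<tau>2: "0 < \<tau>" "\<tau> \<le> 2 * \<rho>" using \<tau> r0 r2 by (auto simp: \<rho>_def)
      have k: "t / (8 * \<rho>) \<le> cmod (wave_kernel t \<tau> \<rho>)"
        using wave_kernel_ge_resonant[OF tpos r2] \<tau> by (simp add: \<rho>_def)
      have "g \<le> c1 * t\<^sup>2 / 64 * 2 powr (1 - 2 * H) * \<rho> powr - (2 * H + 1 + \<beta>)"
        unfolding g_def using c1 r0 r3 H \<beta> by (intro mult_left_mono powr_mono2') auto
      also have "\<dots> = (t / (8 * \<rho>))\<^sup>2 * ((2 * \<rho>) powr (1 - 2 * H) * (c1 * \<rho> powr - \<beta>))"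
        using r0 by (simp add: powr_mult power_mult_distrib power_divide powr_diff powr_add powr_minus_divide powr_numeral
            field_simps power2_eq_square)
      also have "\<dots> \<le> (cmod (wave_kernel t \<tau> \<rho>))\<^sup>2 * (\<bar>\<tau>\<bar> powr (1 - 2 * H) * h \<xi>)"
      proof (intro mult_mono power_mono k)
        show "(2 * \<rho>) powr (1 - 2 * H) \<le> \<bar>\<tau>\<bar> powr (1 - 2 * H)"
          using \<tau>2 H by (intro powr_mono2') auto
        show "c1 * \<rho> powr - \<beta> \<le> h \<xi>" unfolding \<rho>_def using r0 by (intro h_ge) (auto simp: \<rho>_def)
      qed (use tpos r0 c1 in auto)
      finally show ?thesis by (simp add: wave_density_def \<rho>_def)
    qed
    have "ennreal (c * \<delta> powr (2 * H + 1 + \<beta> - CARD('n)) * (\<Sum>k\<in>K. (z k)\<^sup>2))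
       \<le> ennreal (g / t) * ennreal (2 * pi * \<delta> powr - DIM(real^'n) * (\<Sum>k\<in>K. (z k)\<^sup>2))"
    proof -
      have "c * \<delta> powr (2 * H + 1 + \<beta> - CARD('n)) = t0 * c1 / 64 * 2 powr (1 - 2 * H) * (Q powr - (2 * H + 1 + \<beta>) * \<delta> powr (2 * H + 1 + \<beta>)) * (2 * pi * \<delta> powr - DIM(real^'n))"
        unfolding c_def by (simp add: powr_diff powr_minus_divide)
      also have "Q powr - (2 * H + 1 + \<beta>) * \<delta> powr (2 * H + 1 + \<beta>) = (Q / \<delta>) powr - (2 * H + 1 + \<beta>)"
      proof -
        have "Q powr - s * \<delta> powr s = (Q / \<delta>) powr - s" for s
          using Q \<delta> by (simp add: powr_divide powr_minus_divide)
        then show ?thesis .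
      qed
      also have "t0 * c1 / 64 * 2 powr (1 - 2 * H) * (Q / \<delta>) powr - (2 * H + 1 + \<beta>) \<le> t * c1 / 64 * 2 powr (1 - 2 * H) * (Q / \<delta>) powr - (2 * H + 1 + \<beta>)"
        using t c1 by (intro mult_right_mono divide_right_mono) auto
      also have "\<dots> = g / t" using tpos by (simp add: g_def power2_eq_square)
      finally have "c * \<delta> powr (2 * H + 1 + \<beta> - CARD('n)) \<le> g / t * (2 * pi * \<delta> powr - DIM(real^'n))"
        by (simp add: mult_right_mono)
      then have "c * \<delta> powr (2 * H + 1 + \<beta> - CARD('n)) * (\<Sum>k\<in>K. (z k)\<^sup>2) \<le> g / t * (2 * pi * \<delta> powr - DIM(real^'n)) * (\<Sum>k\<in>K. (z k)\<^sup>2)"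
        by (intro mult_right_mono) (auto intro: sum_nonneg)
      then show ?thesis using g tpos by (subst ennreal_mult'[symmetric]) (auto simp: mult.assoc intro!: ennreal_leI)
    qed
    also have "ennreal (2 * pi * \<delta> powr - DIM(real^'n) * (\<Sum>k\<in>K. (z k)\<^sup>2)) = (\<integral>\<^sup>+\<xi>. ennreal (?P \<xi> * indicator B \<xi>) \<partial>lborel)"
      unfolding B_def by (rule nn_integral_trig_polynomial_box[OF K \<delta>(1) e, symmetric])
    also have "ennreal (g / t) * \<dots> = (\<integral>\<^sup>+\<xi>. ennreal (g / t) * ennreal (?P \<xi> * indicator B \<xi>) \<partial>lborel)"
      by (intro nn_integral_cmult[symmetric]) measurable
    also have "\<dots> \<le> (\<integral>\<^sup>+\<xi>. (\<integral>\<^sup>+\<tau>. ennreal (?P \<xi> * wave_density H h t (\<tau>, \<xi>)) \<partial>lborel) \<partial>lborel)"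
    proof (rule nn_integral_mono)
      fix \<xi> :: "real^'n"
      show "ennreal (g / t) * ennreal (?P \<xi> * indicator B \<xi>) \<le> (\<integral>\<^sup>+\<tau>. ennreal (?P \<xi> * wave_density H h t (\<tau>, \<xi>)) \<partial>lborel)"
      proof (cases "\<xi> \<in> B")
        case True
        \<comment> \<open>The resonance window just above \<tau> = norm \<xi> has length
          1/t.\<close>
        have "ennreal (g / t) * ennreal (?P \<xi>) = (\<integral>\<^sup>+\<tau>. ennreal (?P \<xi> * g) * indicator {norm \<xi><..norm \<xi> + 1 / t} \<tau> \<partial>lborel)"
        proof -
          have "(\<integral>\<^sup>+\<tau>. ennreal (?P \<xi> * g) * indicator {norm \<xi><..norm \<xi> + 1 / t} \<tau> \<partial>lborel)
            = ennreal (?P \<xi> * g) * ennreal (1 / t)"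
            using tpos by (subst nn_integral_cmult_indicator) simp_all
          then show ?thesis using tpos g by (simp add: ennreal_mult[symmetric] mult.commute)
        qed
        also have "\<dots> \<le> (\<integral>\<^sup>+\<tau>. ennreal (?P \<xi> * wave_density H h t (\<tau>, \<xi>)) \<partial>lborel)"
          using dens[OF True]
          by (intro nn_integral_mono) (auto split: split_indicator intro!: ennreal_leI mult_left_mono)
        finally show ?thesis using True by simp
      qed simp
    qed
    also have "\<dots> = (\<integral>\<^sup>+p. ennreal (?P (snd p) * wave_density H h t p) \<partial>?L)"
      using lborel_pair.nn_integral_snd[of "\<lambda>p. ennreal (?P (snd p) * wave_density H h t p)"] by simp
    also have "\<dots> = ennreal (LINT p|?L. ?P (snd p) * wave_density H h t p)"
      using wave_cov_quadratic_form(2)[OF int K, of z "\<lambda>k. x + (real k * \<delta>) *\<^sub>R ?e"] h_nonneg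
      unfolding P by (intro nn_integral_eq_integral) (auto simp: wave_density_nonneg)
    finally show ?thesis
      unfolding P using h_nonneg by (subst (asm) ennreal_le_iff) (auto intro!: integral_nonneg_AE simp: wave_density_nonneg)
  qed
  ultimately show ?thesis by blast
qed

text \<open>The Fourier lower bound is fed into the Gaussian small ball estimate. The constant
  \<open>s\<close> depends on t0 but not on the time, base point, spacing or number of points, as
  the union bounds over grids require.\<close>

lemma wave_small_ball:
  fixes M :: "'w measure"
    and u :: "real \<Rightarrow> real^'n \<Rightarrow> 'w \<Rightarrow> real^'d"
    and h :: "real^'n \<Rightarrow> real"
    and H \<beta> c1 c2 cH t0 \<alpha> :: real
    and i :: 'n and j :: 'd
  assumes H: "1/2 \<le> H" "H < 1"
    and beta: "0 < \<beta>" "\<beta> < real CARD('n)"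
    and beta2: "real CARD('n) - 2 * H - 1 < \<beta>"
    and h_meas: "h \<in> borel_measurable lborel"
    and h_nonneg: "\<forall>\<xi>. 0 \<le> h \<xi>"
    and c12: "0 < c1" "c1 \<le> c2"
    and h_bounds: "\<forall>\<xi>. \<xi> \<noteq> 0 \<longrightarrow>
        c1 * norm \<xi> powr (- \<beta>) \<le> h \<xi> \<and> h \<xi> \<le> c2 * norm \<xi> powr (- \<beta>)"
    and cH: "0 < cH"
    and M: "prob_space M"
    and u_meas: "\<forall>t x. u t x \<in> borel_measurable M"
    and u_gauss: "\<forall>S (c :: real \<times> (real^'n) \<Rightarrow> real^'d). finite S \<longrightarrow> S \<subseteq> {p. 0 \<le> fst p} \<longrightarrow>
        centered_gaussian_rv M (\<lambda>\<omega>. \<Sum>p\<in>S. c p \<bullet> u (fst p) (snd p) \<omega>)"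
    and u_cov: "\<forall>t x s y j k. 0 \<le> t \<longrightarrow> 0 \<le> s \<longrightarrow>
        complex_of_real (prob_space.expectation M (\<lambda>\<omega>. u t x \<omega> $ j * u s y \<omega> $ k))
          = (if j = k then wave_cov cH H h t x s y else 0)"
    and t0: "0 < t0"
    and \<alpha>: "\<alpha> = (2 * H + 1 - real CARD('n) + \<beta>) / 2"
  shows "\<exists>s>0. \<forall>t x \<delta> n. t0 \<le> t \<longrightarrow> 0 < \<delta> \<longrightarrow> \<delta> \<le> t0 / 8 \<longrightarrow>
    measure M {\<omega>\<in>space M. \<forall>k\<in>{1..n::nat}. \<bar>u t (x + (real k * \<delta>) *\<^sub>R axis i 1) \<omega> $ j - u t x \<omega> $ j\<bar> \<le> s * \<delta> powr \<alpha>}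
      \<le> exp (- real n)"
proof -
  interpret prob_space M by fact
  obtain c where c: "0 < c" and lower: "\<And>t \<delta> K z x. t0 \<le> t \<Longrightarrow> 0 < \<delta> \<Longrightarrow> \<delta> \<le> t0 / 8 \<Longrightarrow> finite K \<Longrightarrow>
     integrable (lborel \<Otimes>\<^sub>M lborel) (wave_density H h t) \<Longrightarrow>
     c * \<delta> powr (2 * H + 1 + \<beta> - CARD('n)) * (\<Sum>k\<in>K. (z k)\<^sup>2)
      \<le> (LINT p|(lborel \<Otimes>\<^sub>M lborel).
        (cmod (\<Sum>k\<in>K. complex_of_real (z k) * cis (- ((x + (real k * \<delta>) *\<^sub>R axis i 1) \<bullet> snd p))))\<^sup>2 * wave_density H h t p)"
    using wave_quadratic_form_ge[OF H(1) beta(1) h_meas _ c12(1) _ t0, of i] h_nonneg h_bounds by blast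
  define \<sigma>0 where "\<sigma>0 = sqrt (cH * c)"
  have \<sigma>0: "0 < \<sigma>0" "\<sigma>0\<^sup>2 = cH * c" using cH c by (simp_all add: \<sigma>0_def)
  have um [measurable]: "u t x \<in> borel_measurable M" for t x using u_meas by blast
  have um' [measurable]: "(\<lambda>\<omega>. u t x \<omega> $ j) \<in> borel_measurable M" for t x
    by (rule measurable_compose[OF um]) simp
  show ?thesis
  \<comment> \<open>Together with the factor exp(1/2) per coordinate, exp(-3/2) leaves exp(-1) for
    each of the n increments.\<close>
  proof (intro exI[of _ "\<sigma>0 * exp (- 3/2)"] conjI allI impI)
    show "0 < \<sigma>0 * exp (- 3/2)" using \<sigma>0 by simp
    fix t x \<delta> and n :: nat
    assume t: "t0 \<le> t" and \<delta>: "0 < \<delta>" "\<delta> \<le> t0 / 8"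
    define y where "y k = x + (real k * \<delta>) *\<^sub>R (axis i 1 :: real^'n)" for k :: nat
    define X where "X k \<omega> = u t (y k) \<omega> $ j" for k \<omega>
    define N where "N = {0..n}"
    have [measurable]: "X k \<in> borel_measurable M" for k unfolding X_def by measurable
    have tn: "0 \<le> t" using t t0 by simp
    have inj: "inj_on (\<lambda>k. (t, y k)) K" for K
      using \<delta> by (auto simp: inj_on_def y_def axis_eq_0_iff)
    have gauss: "centered_gaussian_rv M (\<lambda>\<omega>. \<Sum>k\<in>K. w k * X k \<omega>)" if "finite K" for K w
    proof -
      \<comment> \<open>The Gaussian hypothesis indexes its coefficients by space-time points, so
        they are transported along the inverse of the injective map from \<open>k\<close> to
        \<open>(t, y k)\<close>; \<open>axis j 1\<close> selects the component.\<close>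
      define cc where "cc p = w (the_inv_into K (\<lambda>k. (t, y k)) p) *\<^sub>R (axis j 1 :: real^'d)" for p
      have "centered_gaussian_rv M (\<lambda>\<omega>. \<Sum>p\<in>(\<lambda>k. (t, y k)) ` K. cc p \<bullet> u (fst p) (snd p) \<omega>)"
        by (rule u_gauss[rule_format]) (use that tn in auto)
      also have "(\<lambda>\<omega>. \<Sum>p\<in>(\<lambda>k. (t, y k)) ` K. cc p \<bullet> u (fst p) (snd p) \<omega>) = (\<lambda>\<omega>. \<Sum>k\<in>K. w k * X k \<omega>)"
      proof
        fix \<omega>
        have "cc (t, y k) \<bullet> u t (y k) \<omega> = w k * X k \<omega>" if "k \<in> K" for k
          unfolding cc_def X_def the_inv_into_f_f[OF inj that] by (simp add: inner_axis' inner_commute)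
        then show "(\<Sum>p\<in>(\<lambda>k. (t, y k)) ` K. cc p \<bullet> u (fst p) (snd p) \<omega>) = (\<Sum>k\<in>K. w k * X k \<omega>)"
          unfolding sum.reindex[OF inj] by (intro sum.cong) simp_all
      qed
      finally show ?thesis .
    qed
    have sqi: "integrable M (\<lambda>\<omega>. (X k \<omega>)\<^sup>2)" for k
      using centered_gaussian_rv_square(1)[OF gauss[of "{k}" "\<lambda>_. 1"] M] by simp
    have pri: "integrable M (\<lambda>\<omega>. X k \<omega> * X l \<omega>)" for k l
    proof (rule Bochner_Integration.integrable_bound[OF Bochner_Integration.integrable_add[OF sqi[of k] sqi[of l]]])
      show "AE \<omega> in M. norm (X k \<omega> * X l \<omega>) \<le> norm ((X k \<omega>)\<^sup>2 + (X l \<omega>)\<^sup>2)"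
      proof (rule AE_I2)
        fix \<omega>
        have "2 * (\<bar>X k \<omega>\<bar> * \<bar>X l \<omega>\<bar>) \<le> (X k \<omega>)\<^sup>2 + (X l \<omega>)\<^sup>2"
          using sum_squares_bound[of "\<bar>X k \<omega>\<bar>" "\<bar>X l \<omega>\<bar>"] by (simp add: mult.assoc)
        moreover have "0 \<le> \<bar>X k \<omega>\<bar> * \<bar>X l \<omega>\<bar>" by simp
        ultimately have "\<bar>X k \<omega>\<bar> * \<bar>X l \<omega>\<bar> \<le> (X k \<omega>)\<^sup>2 + (X l \<omega>)\<^sup>2" by linarith
        then show "norm (X k \<omega> * X l \<omega>) \<le> norm ((X k \<omega>)\<^sup>2 + (X l \<omega>)\<^sup>2)"
          by (simp add: abs_mult)
      qed
    qed measurable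
    have dens: "integrable (lborel \<Otimes>\<^sub>M lborel) (wave_density H h t)"
      using h_nonneg h_bounds by (intro integrable_wave_density[OF H beta beta2 h_meas _ _ tn]) auto
    have var: "\<sigma>0\<^sup>2 * \<delta> powr (2 * \<alpha>) * (\<Sum>k\<in>K. (w k)\<^sup>2) \<le> expectation (\<lambda>\<omega>. (\<Sum>k\<in>K. w k * X k \<omega>)\<^sup>2)" if K: "finite K" for K w
    proof -
      let ?I = "LINT p|(lborel \<Otimes>\<^sub>M lborel). (cmod (\<Sum>k\<in>K. complex_of_real (w k) * cis (- (y k \<bullet> snd p))))\<^sup>2 * wave_density H h t p"
      have "expectation (\<lambda>\<omega>. (\<Sum>k\<in>K. w k * X k \<omega>)\<^sup>2) = expectation (\<lambda>\<omega>. \<Sum>k\<in>K. \<Sum>l\<in>K. (w k * w l) * (X k \<omega> * X l \<omega>))"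
        by (simp add: power2_eq_square sum_product ac_simps)
      also have "\<dots> = (\<Sum>k\<in>K. \<Sum>l\<in>K. (w k * w l) * expectation (\<lambda>\<omega>. X k \<omega> * X l \<omega>))"
        by (simp add: Bochner_Integration.integral_sum Bochner_Integration.integrable_sum pri)
      finally have "complex_of_real (expectation (\<lambda>\<omega>. (\<Sum>k\<in>K. w k * X k \<omega>)\<^sup>2))
        = (\<Sum>k\<in>K. \<Sum>l\<in>K. complex_of_real (w k * w l) * wave_cov cH H h t (y k) t (y l))"
        using u_cov tn by (simp add: X_def)
      also have "\<dots> = complex_of_real (cH * ?I)"
        by (rule wave_cov_quadratic_form(1)[OF dens K])
      finally have eq: "expectation (\<lambda>\<omega>. (\<Sum>k\<in>K. w k * X k \<omega>)\<^sup>2) = cH * ?I" by (simp only: of_real_eq_iff)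
      have "c * \<delta> powr (2 * H + 1 + \<beta> - CARD('n)) * (\<Sum>k\<in>K. (w k)\<^sup>2) \<le> ?I"
        unfolding y_def by (rule lower[OF t \<delta> K dens])
      then have "cH * (c * \<delta> powr (2 * H + 1 + \<beta> - CARD('n)) * (\<Sum>k\<in>K. (w k)\<^sup>2)) \<le> cH * ?I"
        using cH by (intro mult_left_mono) auto
      moreover have "2 * \<alpha> = 2 * H + 1 + \<beta> - CARD('n)" by (simp add: \<alpha>)
      ultimately show ?thesis unfolding eq \<sigma>0 by (simp add: ac_simps)
    qed
    define D where "D k \<omega> = X k \<omega> - X 0 \<omega>" for k \<omega>
    \<comment> \<open>A combination of increments from \<open>X 0\<close> is a combination of the
      values on \<open>{0..n}\<close> whose coefficient at 0 is minus the sum of the others.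
      Dropping the square of that coefficient leaves the sum over \<open>{1..n}\<close>.\<close>
    define w where "w z k = (if k = 0 then - sum z {1..n} else z k)" for z :: "nat \<Rightarrow> real" and k :: nat
    have N: "N = insert 0 {1..n}" by (auto simp: N_def)
    have comb: "(\<lambda>\<omega>. \<Sum>k\<in>{1..n}. z k * D k \<omega>) = (\<lambda>\<omega>. \<Sum>k\<in>N. w z k * X k \<omega>)" for z
    proof
      fix \<omega>
      have "(\<Sum>k\<in>{1..n}. w z k * X k \<omega>) = (\<Sum>k\<in>{1..n}. z k * X k \<omega>)"
        by (intro sum.cong) (auto simp: w_def)
      then show "(\<Sum>k\<in>{1..n}. z k * D k \<omega>) = (\<Sum>k\<in>N. w z k * X k \<omega>)"
        by (simp add: N w_def D_def right_diff_distrib sum_subtractf sum_distrib_right)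
    qed
    have "measure M {\<omega>\<in>space M. \<forall>k\<in>{1..n}. \<bar>D k \<omega>\<bar> \<le> \<sigma>0 * exp (- 3/2) * \<delta> powr \<alpha>}
      \<le> (exp (1/2) * (\<sigma>0 * exp (- 3/2) * \<delta> powr \<alpha>) / (\<sigma>0 * \<delta> powr \<alpha>)) ^ card {1..n}"
    proof (rule gaussian_small_ball[OF M])
      show "D k \<in> borel_measurable M" for k unfolding D_def by measurable
      show "centered_gaussian_rv M (\<lambda>\<omega>. \<Sum>k\<in>{1..n}. z k * D k \<omega>)" for z
        unfolding comb by (rule gauss) (simp add: N_def)
      show "(\<sigma>0 * \<delta> powr \<alpha>)\<^sup>2 * (\<Sum>k\<in>{1..n}. (z k)\<^sup>2) \<le> expectation (\<lambda>\<omega>. (\<Sum>k\<in>{1..n}. z k * D k \<omega>)\<^sup>2)" for z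
      proof -
        have "(\<Sum>k\<in>{1..n}. (z k)\<^sup>2) = (\<Sum>k\<in>{1..n}. (w z k)\<^sup>2)" by (intro sum.cong) (auto simp: w_def)
        also have "\<dots> \<le> (\<Sum>k\<in>N. (w z k)\<^sup>2)" by (intro sum_mono2) (auto simp: N)
        finally have "(\<sigma>0 * \<delta> powr \<alpha>)\<^sup>2 * (\<Sum>k\<in>{1..n}. (z k)\<^sup>2) \<le> (\<sigma>0 * \<delta> powr \<alpha>)\<^sup>2 * (\<Sum>k\<in>N. (w z k)\<^sup>2)"
          by (rule mult_left_mono) simp
        also have "\<dots> = \<sigma>0\<^sup>2 * \<delta> powr (2 * \<alpha>) * (\<Sum>k\<in>N. (w z k)\<^sup>2)"
          by (simp add: power_mult_distrib power2_eq_square powr_add[symmetric])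
        also have "\<dots> \<le> expectation (\<lambda>\<omega>. (\<Sum>k\<in>N. w z k * X k \<omega>)\<^sup>2)"
          by (rule var) (simp add: N_def)
        finally show ?thesis using fun_cong[OF comb[of z]] by simp
      qed
    qed (use \<sigma>0 \<delta> in auto)
    also have "(exp (1/2) * (\<sigma>0 * exp (- 3/2) * \<delta> powr \<alpha>) / (\<sigma>0 * \<delta> powr \<alpha>)) = exp (1/2 + (- 3/2 :: real))"
      using \<sigma>0 \<delta> by (subst exp_add) simp
    also have "exp (1/2 + (- 3/2 :: real)) ^ card {1..n} = exp (- real n)"
      by (simp add: exp_of_nat_mult[symmetric])
    finally show "measure M {\<omega>\<in>space M. \<forall>k\<in>{1..n}. \<bar>u t (x + (real k * \<delta>) *\<^sub>R axis i 1) \<omega> $ j - u t x \<omega> $ j\<bar>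
        \<le> \<sigma>0 * exp (- 3/2) * \<delta> powr \<alpha>} \<le> exp (- real n)"
      by (simp add: D_def X_def y_def)
  qed
qed

section \<open>From small balls to lower bounds for the oscillation\<close>

text \<open>Borel-Cantelli over finite sets of base points. The parameter \<theta> trades size for
  probability: a smaller value lowers the guaranteed increment but improves the failure probability
  exp(-l/\<theta>), which has to beat the number of base points.\<close>

lemma large_increments_eventually:
  fixes M :: "'w measure" and v :: "real \<Rightarrow> real^'n \<Rightarrow> 'w \<Rightarrow> real" and D :: "nat \<Rightarrow> (real \<times> (real^'n)) set"
  assumes M: "prob_space M"
    and v [measurable]: "\<And>t x. v t x \<in> borel_measurable M"
    and small_ball: "\<And>t x \<delta> n. t0 \<le> t \<Longrightarrow> 0 < \<delta> \<Longrightarrow> \<delta> \<le> \<delta>0 \<Longrightarrow>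
      measure M {\<omega>\<in>space M. \<forall>k\<in>{1..n::nat}. \<bar>v t (x + (real k * \<delta>) *\<^sub>R axis i 1) \<omega> - v t x \<omega>\<bar> \<le> s * \<delta> powr \<alpha>}
        \<le> exp (- real n)"
    and \<delta>0: "0 < \<delta>0" and \<theta>: "0 < \<theta>"
    and D: "\<And>n. finite (D n)" "\<And>n p. p \<in> D n \<Longrightarrow> t0 \<le> fst p"
    and l: "eventually (\<lambda>n. 1 \<le> l n) sequentially"
    and sum: "summable (\<lambda>n. real (card (D n)) * exp (- (l n / \<theta>)))"
  shows "AE \<omega> in M. eventually (\<lambda>n. \<forall>p\<in>D n. \<exists>y. (\<forall>k. \<bar>y $ k - snd p $ k\<bar> \<le> (1/2) ^ Suc n) \<and>
      s * (\<theta> * (1/2) ^ Suc n / l n) powr \<alpha> < \<bar>v (fst p) y \<omega> - v (fst p) (snd p) \<omega>\<bar>) sequentially"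
proof -
  interpret prob_space M by fact
  \<comment> \<open>About l/\<theta> points at this spacing fill a segment of length at most
    2^(-n-1). Half of the radius 2^(-n) is thus left for moving the base point.\<close>
  define \<delta> where "\<delta> n = \<theta> * (1/2) ^ Suc n / l n" for n
  define m where "m n = nat \<lfloor>l n / \<theta>\<rfloor>" for n
  define F where "F n p = {\<omega>\<in>space M. \<forall>k\<in>{1..m n}.
      \<bar>v (fst p) (snd p + (real k * \<delta> n) *\<^sub>R axis i 1) \<omega> - v (fst p) (snd p) \<omega>\<bar> \<le> s * \<delta> n powr \<alpha>}" for n p
  define A where "A n = (\<Union>p\<in>D n. F n p)" for n
  have [measurable]: "F n p \<in> sets M" for n p unfolding F_def by measurable
  have [measurable]: "A n \<in> sets M" for n unfolding A_def by (intro sets.finite_UN D) measurable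
  have small: "eventually (\<lambda>n. \<theta> * (1/2) ^ Suc n \<le> \<delta>0) sequentially"
  proof -
    have "(\<lambda>n. \<theta> * (1/2) ^ Suc n) \<longlonglongrightarrow> \<theta> * 0"
      by (intro tendsto_mult tendsto_const LIMSEQ_Suc LIMSEQ_power_zero) simp
    then have "eventually (\<lambda>n. \<theta> * (1/2) ^ Suc n < \<delta>0) sequentially"
      using \<delta>0 by (intro order_tendstoD(2)) auto
    then show ?thesis by eventually_elim simp
  qed
  have "eventually (\<lambda>n. measure M (A n) \<le> exp 1 * (real (card (D n)) * exp (- (l n / \<theta>)))) sequentially"
    using l small
  proof eventually_elim
    case (elim n)
    have \<delta>n: "0 < \<delta> n" "\<delta> n \<le> \<delta>0"
    proof -
      show "0 < \<delta> n" using elim \<theta> by (simp add: \<delta>_def)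
      have "\<delta> n \<le> \<theta> * (1/2) ^ Suc n / 1" unfolding \<delta>_def using elim \<theta> by (intro divide_left_mono) auto
      then show "\<delta> n \<le> \<delta>0" using elim by simp
    qed
    \<comment> \<open>Rounding the number of points down costs only a factor exp(1).\<close>
    have "l n / \<theta> - 1 \<le> real (m n)" unfolding m_def by linarith
    then have "exp (- real (m n)) \<le> exp (1 + - (l n / \<theta>))" by simp
    also have "\<dots> = exp 1 * exp (- (l n / \<theta>))" by (rule exp_add)
    finally have F: "measure M (F n p) \<le> exp 1 * exp (- (l n / \<theta>))" if "p \<in> D n" for p
      using small_ball[OF D(2)[OF that] \<delta>n, of "m n" "snd p"] unfolding F_def by simp
    have "measure M (A n) \<le> (\<Sum>p\<in>D n. measure M (F n p))"
      unfolding A_def by (rule finite_measure_subadditive_finite) (auto simp: D)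
    also have "\<dots> \<le> (\<Sum>p\<in>D n. exp 1 * exp (- (l n / \<theta>)))" by (rule sum_mono) (rule F)
    finally show ?case by (simp add: ac_simps)
  qed
  then have "summable (\<lambda>n. measure M (A n))"
    by (intro summable_comparison_test_ev[OF _ summable_mult[OF sum, of "exp 1"]]) simp
  then have "AE \<omega> in M. eventually (\<lambda>n. \<omega> \<in> space M - A n) sequentially"
    by (intro borel_cantelli_AE1) (auto simp: emeasure_eq_measure)
  then show ?thesis
  proof eventually_elim
    case (elim \<omega>)
    from elim l show ?case
    proof eventually_elim
      case (elim n)
      show ?case
      proof
        fix p assume "p \<in> D n"
        then have "\<omega> \<notin> F n p" using elim by (auto simp: A_def)
        then obtain k where k: "k \<in> {1..m n}"
          and less: "s * \<delta> n powr \<alpha> < \<bar>v (fst p) (snd p + (real k * \<delta> n) *\<^sub>R axis i 1) \<omega> - v (fst p) (snd p) \<omega>\<bar>"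
          using elim by (auto simp: F_def not_le)
        have "real k \<le> l n / \<theta>" using k elim \<theta> unfolding m_def by (simp add: le_nat_iff le_floor_iff)
        then have "real k * \<delta> n \<le> l n / \<theta> * \<delta> n" using elim \<theta> by (intro mult_right_mono) (auto simp: \<delta>_def)
        also have "\<dots> = (1/2) ^ Suc n" using elim \<theta> by (simp add: \<delta>_def)
        finally have "real k * \<delta> n \<le> (1/2) ^ Suc n" .
        moreover have "0 \<le> real k * \<delta> n" using elim \<theta> by (simp add: \<delta>_def)
        ultimately have "\<bar>(snd p + (real k * \<delta> n) *\<^sub>R axis i 1) $ q - snd p $ q\<bar> \<le> (1/2) ^ Suc n" for q
          by (simp add: axis_def)
        then show "\<exists>y. (\<forall>k. \<bar>y $ k - snd p $ k\<bar> \<le> (1/2) ^ Suc n) \<and>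
          s * (\<theta> * (1/2) ^ Suc n / l n) powr \<alpha> < \<bar>v (fst p) y \<omega> - v (fst p) (snd p) \<omega>\<bar>"
          using less unfolding \<delta>_def by blast
      qed
    qed
  qed
qed

lemma I_box_mono: "r \<le> r' \<Longrightarrow> I_box r t x \<subseteq> I_box r' t x"
  by (auto simp: I_box_def intro: order_trans)

section \<open>From dyadic radii and grids to the limes inferior over boxes\<close>

text \<open>Between consecutive dyadic radii one factor 2 is lost in r and another in
  \<open>L\<close> by the doubling condition; together they give
  \<open>4 powr - \<alpha>\<close>.\<close>

lemma Liminf_oscillation_ge:
  fixes f :: "real \<times> (real^'n) \<Rightarrow> 'b::real_normed_vector" and L :: "real \<Rightarrow> real"
  assumes dyadic: "eventually (\<lambda>n. \<forall>q\<in>T. \<exists>p\<in>I_box ((1/2) ^ n) (fst q) (snd q).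
      C * ((1/2) ^ n / L ((1/2) ^ n)) powr \<alpha> \<le> norm (f p - f q)) sequentially"
    and C: "0 \<le> C" and \<alpha>: "0 \<le> \<alpha>"
    and anti: "\<And>r r'. 0 < r \<Longrightarrow> r \<le> r' \<Longrightarrow> r' < 1 \<Longrightarrow> L r' \<le> L r"
    and pos: "eventually (\<lambda>n. 1 \<le> L ((1/2) ^ n)) sequentially"
    and doubling: "eventually (\<lambda>n. L ((1/2) ^ Suc n) \<le> 2 * L ((1/2) ^ n)) sequentially"
  shows "ereal (C * 4 powr - \<alpha>) \<le> Liminf (at_right 0) (\<lambda>r. INF q\<in>T. SUP p\<in>I_box r (fst q) (snd q).
          ereal (norm (f p - f q) / (r powr \<alpha> * L r powr - \<alpha>)))"
proof (rule Liminf_bounded)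
  from dyadic pos doubling have "eventually (\<lambda>n. (\<forall>q\<in>T. \<exists>p\<in>I_box ((1/2) ^ n) (fst q) (snd q).
      C * ((1/2) ^ n / L ((1/2) ^ n)) powr \<alpha> \<le> norm (f p - f q)) \<and> 1 \<le> L ((1/2) ^ n) \<and>
      L ((1/2) ^ Suc n) \<le> 2 * L ((1/2) ^ n)) sequentially"
    by eventually_elim simp
  then obtain N where N: "\<And>n q. N \<le> n \<Longrightarrow> q \<in> T \<Longrightarrow> \<exists>p\<in>I_box ((1/2) ^ n) (fst q) (snd q).
      C * ((1/2) ^ n / L ((1/2) ^ n)) powr \<alpha> \<le> norm (f p - f q)"
    "\<And>n. N \<le> n \<Longrightarrow> 1 \<le> L ((1/2) ^ n)" "\<And>n. N \<le> n \<Longrightarrow> L ((1/2) ^ Suc n) \<le> 2 * L ((1/2) ^ n)"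
    unfolding eventually_sequentially by blast
  have "eventually (\<lambda>r::real. r \<in> {0<..<(1/2) ^ Suc N}) (at_right 0)"
    by (rule eventually_at_right_real) simp
  then show "eventually (\<lambda>r. ereal (C * 4 powr - \<alpha>) \<le> (INF q\<in>T. SUP p\<in>I_box r (fst q) (snd q).
          ereal (norm (f p - f q) / (r powr \<alpha> * L r powr - \<alpha>)))) (at_right 0)"
  proof eventually_elim
    case (elim r)
    then have r: "0 < r" "r < (1/2) ^ Suc N" by auto
    \<comment> \<open>The largest dyadic radius not exceeding r; its predecessor \<open>k\<close>
      satisfies r < 2^(-k) = 2 * 2^(-n).\<close>
    define n where "n = (LEAST n. (1/2) ^ n \<le> r)"
    have ex: "\<exists>n. (1/2::real) ^ n \<le> r"
      using real_arch_pow_inv[OF r(1), of "1/2"] by (auto intro: less_imp_le)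
    have n1: "(1/2) ^ n \<le> r" unfolding n_def by (rule LeastI_ex[OF ex])
    \<comment> \<open>Strict inequality with \<open>Suc N\<close> puts the predecessor beyond
      \<open>N\<close> as well; in particular it is positive, so 2^(-k) < 1 as \<open>anti\<close>
      requires.\<close>
    have nN: "Suc N < n"
    proof (rule ccontr)
      assume "\<not> Suc N < n"
      then have "(1/2::real) ^ Suc N \<le> (1/2) ^ n" by (intro power_decreasing) auto
      then show False using n1 r by simp
    qed
    then obtain k where k: "n = Suc k" "N < k" by (cases n) auto
    have n2: "r < (1/2) ^ k"
      using not_less_Least[of k "\<lambda>n. (1/2) ^ n \<le> r"] k by (simp add: n_def[symmetric] not_le)
    have "(1/2::real) ^ k < 1" using k by (simp add: power_less_one_iff)
    then have "L ((1/2) ^ k) \<le> L r" using n2 r by (intro anti) auto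
    moreover have "1 \<le> L ((1/2) ^ k)" "L ((1/2) ^ n) \<le> 2 * L ((1/2) ^ k)" "1 \<le> L ((1/2) ^ n)"
      using N(2,3)[of k] N(2)[of n] k by auto
    ultimately have L: "1 \<le> L r" "L ((1/2) ^ n) \<le> 2 * L r" "1 \<le> L ((1/2) ^ n)" by auto
    have "r / L r / 4 \<le> (1/2) ^ n / L ((1/2) ^ n)"
    proof -
      have "r * L ((1/2) ^ n) \<le> (2 * (1/2) ^ n) * (2 * L r)"
        using n2 r L k by (intro mult_mono) auto
      then show ?thesis using L by (simp add: field_simps)
    qed
    then have "(r / L r / 4) powr \<alpha> \<le> ((1/2) ^ n / L ((1/2) ^ n)) powr \<alpha>"
      using r L \<alpha> by (intro powr_mono2) auto
    moreover have "(r / L r / 4) powr \<alpha> = 4 powr - \<alpha> * (r powr \<alpha> * L r powr - \<alpha>)"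
    proof -
      have "0 < L r" using L by simp
      then show ?thesis using r by (simp add: powr_divide powr_mult powr_minus_divide)
    qed
    ultimately have le: "C * (4 powr - \<alpha> * (r powr \<alpha> * L r powr - \<alpha>)) \<le> C * ((1/2) ^ n / L ((1/2) ^ n)) powr \<alpha>"
      using C by (intro mult_left_mono) auto
    have den: "0 < r powr \<alpha> * L r powr - \<alpha>" using r L by simp
    show ?case
    proof (rule INF_greatest)
      fix q assume "q \<in> T"
      then obtain p where p: "p \<in> I_box ((1/2) ^ n) (fst q) (snd q)"
        and "C * ((1/2) ^ n / L ((1/2) ^ n)) powr \<alpha> \<le> norm (f p - f q)"
        using N(1)[of n q] k by auto
      then have "C * 4 powr - \<alpha> * (r powr \<alpha> * L r powr - \<alpha>) \<le> norm (f p - f q)" using le by simp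
      then have "C * 4 powr - \<alpha> \<le> norm (f p - f q) / (r powr \<alpha> * L r powr - \<alpha>)"
        using den by (simp only: pos_le_divide_eq)
      moreover have "p \<in> I_box r (fst q) (snd q)" using I_box_mono[OF n1] p by blast
      ultimately show "ereal (C * 4 powr - \<alpha>) \<le> (SUP p\<in>I_box r (fst q) (snd q).
          ereal (norm (f p - f q) / (r powr \<alpha> * L r powr - \<alpha>)))"
        by (intro SUP_upper2[of p]) auto
    qed
  qed
qed

text \<open>Coordinates are rounded down to multiples of 2^(-n-1). This may move the time below
  \<open>fst a\<close>, hence the lower limit \<open>fst a / 2\<close>, which holds once the mesh is
  small. The exponent \<open>Suc CARD('n)\<close> counts time and space together.\<close>

lemma dyadic_grid:
  fixes a b :: "real \<times> (real^'n)"
  assumes "0 < fst a"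
  shows "\<exists>R \<ge> 0. \<exists>D :: nat \<Rightarrow> (real \<times> (real^'n)) set.
    (\<forall>n. finite (D n) \<and> real (card (D n)) \<le> (R * 2 ^ n) ^ Suc CARD('n)) \<and>
    (\<forall>n. \<forall>p\<in>D n. fst a / 2 \<le> fst p) \<and>
    eventually (\<lambda>n. \<forall>q\<in>cbox a b. \<exists>p\<in>D n. p \<in> I_box ((1/2) ^ Suc n) (fst q) (snd q)) sequentially"
proof -
  obtain R0 where R0: "\<And>q. q \<in> cbox a b \<Longrightarrow> norm q \<le> R0"
    using bounded_cbox[of a b] unfolding bounded_iff by blast
  define R where "R = nat \<lceil>max R0 1\<rceil>"
  have R: "1 \<le> R" "R0 \<le> real R" unfolding R_def by linarith+
  \<comment> \<open>The index range is twice what points of size R need, which leaves room for the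
    floor.\<close>
  define S :: "nat \<Rightarrow> real set" where "S n = (\<lambda>z. of_int z / 2 ^ Suc n) ` {- int (R * 2 ^ (n + 2)) .. int (R * 2 ^ (n + 2))}" for n
  define D where "D n = {p :: real \<times> (real^'n). fst p \<in> S n \<and> (\<forall>l. snd p $ l \<in> S n) \<and> fst a / 2 \<le> fst p}" for n
  have Sfin: "finite (S n)" for n by (simp add: S_def)
  have Scard: "card (S n) \<le> 16 * R * 2 ^ n" for n
  proof -
    have "card (S n) \<le> card {- int (R * 2 ^ (n + 2)) .. int (R * 2 ^ (n + 2))}"
      unfolding S_def by (rule card_image_le) simp
    also have "\<dots> = 2 * (R * 2 ^ (n + 2)) + 1"
      by (simp add: nat_eq_iff)
    also have "\<dots> \<le> 16 * R * 2 ^ n"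
    proof -
      have "1 \<le> R * 2 ^ n" using R by simp
      then show ?thesis by simp
    qed
    finally show ?thesis .
  qed
  define V where "V n = {x :: real^'n. \<forall>l. x $ l \<in> S n}" for n
  have Vim: "V n \<subseteq> vec_lambda ` (PiE UNIV (\<lambda>_. S n))" for n
  proof
    fix x assume "x \<in> V n"
    then have "vec_nth x \<in> PiE UNIV (\<lambda>_. S n)" by (simp add: V_def PiE_UNIV_domain)
    then show "x \<in> vec_lambda ` (PiE UNIV (\<lambda>_. S n))" by (metis image_eqI vec_nth_inverse)
  qed
  have PiEfin: "finite (PiE (UNIV :: 'n set) (\<lambda>_. S n))" for n by (intro finite_PiE) (auto simp: Sfin)
  have Vfin: "finite (V n)" for n by (rule finite_subset[OF Vim]) (intro finite_imageI PiEfin)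
  have Vcard: "card (V n) \<le> card (S n) ^ CARD('n)" for n
  proof -
    have "card (V n) \<le> card (vec_lambda ` (PiE (UNIV :: 'n set) (\<lambda>_. S n)) :: (real^'n) set)"
      by (intro card_mono Vim finite_imageI PiEfin)
    also have "\<dots> \<le> card (PiE (UNIV :: 'n set) (\<lambda>_. S n))" by (rule card_image_le[OF PiEfin])
    also have "\<dots> = card (S n) ^ CARD('n)" by (simp add: card_PiE)
    finally show ?thesis .
  qed
  have Dsub: "D n \<subseteq> S n \<times> V n" for n by (auto simp: D_def V_def mem_Times_iff)
  show ?thesis
  proof (intro exI[of _ "real (16 * R)"] exI[of _ D] conjI allI ballI)
    show "0 \<le> real (16 * R)" by simp
    fix n
    show "finite (D n)" by (rule finite_subset[OF Dsub]) (intro finite_cartesian_product Sfin Vfin)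
    have "card (D n) \<le> card (S n \<times> V n)" by (intro card_mono Dsub finite_cartesian_product Sfin Vfin)
    also have "\<dots> \<le> card (S n) * card (S n) ^ CARD('n)" by (simp add: card_cartesian_product Vcard)
    also have "\<dots> = card (S n) ^ Suc CARD('n)" by simp
    also have "\<dots> \<le> (16 * R * 2 ^ n) ^ Suc CARD('n)" by (intro power_mono Scard) simp
    finally have "real (card (D n)) \<le> real ((16 * R * 2 ^ n) ^ Suc CARD('n))" by (rule of_nat_mono)
    then show "real (card (D n)) \<le> (real (16 * R) * 2 ^ n) ^ Suc CARD('n)" by simp
    show "fst a / 2 \<le> fst p" if "p \<in> D n" for p using that by (simp add: D_def)
  next
    have "(\<lambda>n. (1/2::real) ^ Suc n) \<longlonglongrightarrow> 0"
      by (intro LIMSEQ_Suc LIMSEQ_power_zero) simp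
    moreover have "0 < fst a / 2" using assms by simp
    ultimately have "eventually (\<lambda>n. (1/2::real) ^ Suc n < fst a / 2) sequentially"
      by (rule order_tendstoD(2))
    then show "eventually (\<lambda>n. \<forall>q\<in>cbox a b. \<exists>p\<in>D n. p \<in> I_box ((1/2) ^ Suc n) (fst q) (snd q)) sequentially"
    proof eventually_elim
      case (elim n)
      define g :: "real \<Rightarrow> real" where "g c = of_int \<lfloor>c * 2 ^ Suc n\<rfloor> / 2 ^ Suc n" for c
      have g: "c - (1/2) ^ Suc n \<le> g c" "g c \<le> c" for c
      proof -
        have "(c * 2 ^ Suc n - 1) / 2 ^ Suc n \<le> g c" "g c \<le> (c * 2 ^ Suc n) / 2 ^ Suc n"
          unfolding g_def by (rule divide_right_mono, linarith, simp)+
        then show "c - (1/2) ^ Suc n \<le> g c" "g c \<le> c"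
          by (simp_all add: diff_divide_distrib power_divide)
      qed
      have gS: "g c \<in> S n" if "\<bar>c\<bar> \<le> R0" for c
      proof -
        have "\<bar>c * 2 ^ Suc n\<bar> \<le> real R * 2 ^ Suc n" using that R by (simp add: abs_mult)
        moreover have "1 \<le> real R * 2 ^ Suc n"
        proof -
          have "1 * 1 \<le> real R * 2 ^ Suc n" using R by (intro mult_mono one_le_power) auto
          then show ?thesis by simp
        qed
        moreover have "real (R * 2 ^ (n + 2)) = 2 * (real R * 2 ^ Suc n)" by simp
        ultimately have "- int (R * 2 ^ (n + 2)) \<le> \<lfloor>c * 2 ^ Suc n\<rfloor>" "\<lfloor>c * 2 ^ Suc n\<rfloor> \<le> int (R * 2 ^ (n + 2))"
          unfolding le_floor_iff floor_le_iff of_int_minus of_int_of_nat_eq by linarith+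
        then show ?thesis unfolding S_def g_def by (intro imageI) simp
      qed
      show ?case
      proof
        fix q assume q: "q \<in> cbox a b"
        have nq: "\<bar>fst q\<bar> \<le> R0" "\<bar>snd q $ k\<bar> \<le> R0" for k
          using R0[OF q] norm_fst_le[of "fst q" "snd q"] norm_snd_le[of "snd q" "fst q"] component_le_norm_cart[of "snd q" k] by auto
        have "fst a \<le> fst q" using q by (cases a; cases b; cases q) (auto simp: cbox_Pair_eq)
        then have "(g (fst q), \<chi> k. g (snd q $ k)) \<in> D n"
          using elim g[of "fst q"] by (auto simp: D_def intro!: gS nq)
        moreover have "(g (fst q), \<chi> k. g (snd q $ k)) \<in> I_box ((1/2) ^ Suc n) (fst q) (snd q)"
        proof -
          have "\<bar>g c - c\<bar> \<le> (1/2) ^ Suc n" for c using g[of c] by (simp only: abs_le_iff) linarith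
          then show ?thesis by (simp add: I_box_def del: power_Suc)
        qed
        ultimately show "\<exists>p\<in>D n. p \<in> I_box ((1/2) ^ Suc n) (fst q) (snd q)" by blast
      qed
    qed
  qed
qed

text \<open>The step from finitely many grid points to every q in \<open>T\<close>: a grid point p
  near q has a partner y with a large increment from p, and both lie in the box of radius 2^(-n)
  around q.\<close>

lemma AE_Liminf_oscillation_ge:
  fixes M :: "'w measure" and u :: "real \<Rightarrow> real^'n \<Rightarrow> 'w \<Rightarrow> real^'d"
  assumes M: "prob_space M"
    and u: "\<And>t x. u t x \<in> borel_measurable M"
    and small_ball: "\<And>t x \<delta> n. t0 \<le> t \<Longrightarrow> 0 < \<delta> \<Longrightarrow> \<delta> \<le> \<delta>0 \<Longrightarrow>
      measure M {\<omega>\<in>space M. \<forall>k\<in>{1..n::nat}. \<bar>u t (x + (real k * \<delta>) *\<^sub>R axis i 1) \<omega> $ j - u t x \<omega> $ j\<bar> \<le> s * \<delta> powr \<alpha>}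
        \<le> exp (- real n)"
    and const: "0 < \<delta>0" "0 < \<theta>" "0 < s" "0 \<le> \<alpha>"
    and D: "\<And>n. finite (D n)" "\<And>n p. p \<in> D n \<Longrightarrow> t0 \<le> fst p"
    and near: "eventually (\<lambda>n. \<forall>q\<in>T. \<exists>p\<in>D n. p \<in> I_box ((1/2) ^ Suc n) (fst q) (snd q)) sequentially"
    and sum: "summable (\<lambda>n. real (card (D n)) * exp (- (L ((1/2) ^ n) / \<theta>)))"
    and anti: "\<And>r r'. 0 < r \<Longrightarrow> r \<le> r' \<Longrightarrow> r' < 1 \<Longrightarrow> L r' \<le> L r"
    and pos: "eventually (\<lambda>n. 1 \<le> L ((1/2) ^ n)) sequentially"
    and doubling: "eventually (\<lambda>n. L ((1/2) ^ Suc n) \<le> 2 * L ((1/2) ^ n)) sequentially"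
  shows "AE \<omega> in M. ereal (s / 2 * (\<theta> / 2) powr \<alpha> * 4 powr - \<alpha>) \<le>
    Liminf (at_right 0) (\<lambda>r. INF q\<in>T. SUP p\<in>I_box r (fst q) (snd q).
      ereal (norm (u (fst p) (snd p) \<omega> - u (fst q) (snd q) \<omega>) / (r powr \<alpha> * L r powr - \<alpha>)))"
proof -
  have v: "(\<lambda>\<omega>. u t x \<omega> $ j) \<in> borel_measurable M" for t x
    by (rule measurable_compose[OF u]) simp
  have "AE \<omega> in M. eventually (\<lambda>n. \<forall>p\<in>D n. \<exists>y. (\<forall>k. \<bar>y $ k - snd p $ k\<bar> \<le> (1/2) ^ Suc n) \<and>
      s * (\<theta> * (1/2) ^ Suc n / L ((1/2) ^ n)) powr \<alpha> < \<bar>u (fst p) y \<omega> $ j - u (fst p) (snd p) \<omega> $ j\<bar>) sequentially"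
    by (rule large_increments_eventually[OF M v small_ball const(1,2) D pos sum])
  then show ?thesis
  proof eventually_elim
    case (elim \<omega>)
    let ?f = "\<lambda>p. u (fst p) (snd p) \<omega>"
    from elim near pos have "eventually (\<lambda>n. \<forall>q\<in>T. \<exists>p\<in>I_box ((1/2) ^ n) (fst q) (snd q).
      (s / 2 * (\<theta> / 2) powr \<alpha>) * ((1/2) ^ n / L ((1/2) ^ n)) powr \<alpha> \<le> norm (?f p - ?f q)) sequentially"
    proof eventually_elim
      case (elim n)
      let ?l = "L ((1/2) ^ n)"
      let ?c = "(s / 2 * (\<theta> / 2) powr \<alpha>) * ((1/2) ^ n / ?l) powr \<alpha>"
      have c: "s * (\<theta> * (1/2) ^ Suc n / ?l) powr \<alpha> = 2 * ?c"
      proof -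
        have "\<theta> * (1/2) ^ Suc n / ?l = (\<theta> / 2) * ((1/2) ^ n / ?l)" by simp
        moreover have "((\<theta> / 2) * ((1/2) ^ n / ?l)) powr \<alpha> = (\<theta> / 2) powr \<alpha> * ((1/2) ^ n / ?l) powr \<alpha>"
          using const(2) elim(3) by (subst powr_mult) simp_all
        ultimately show ?thesis by simp
      qed
      show ?case
      proof
        fix q assume "q \<in> T"
        then obtain p where p: "p \<in> D n" "p \<in> I_box ((1/2) ^ Suc n) (fst q) (snd q)" using elim(2) by blast
        obtain y where y: "\<And>k. \<bar>y $ k - snd p $ k\<bar> \<le> (1/2) ^ Suc n"
          and less: "2 * ?c < \<bar>u (fst p) y \<omega> $ j - u (fst p) (snd p) \<omega> $ j\<bar>"
          using elim(1) p(1) unfolding c by blast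
        have half: "(1/2::real) ^ n = (1/2) ^ Suc n + (1/2) ^ Suc n" "0 \<le> (1/2::real) ^ Suc n" by simp_all
        have pq: "\<bar>fst p - fst q\<bar> \<le> (1/2) ^ Suc n" "\<bar>snd p $ k - snd q $ k\<bar> \<le> (1/2) ^ Suc n" for k
          using p(2) by (auto simp: I_box_def)
        have 1: "p \<in> I_box ((1/2) ^ n) (fst q) (snd q)"
          using half by (intro subsetD[OF I_box_mono p(2)]) linarith
        have "\<bar>y $ k - snd q $ k\<bar> \<le> (1/2) ^ n" for k
          using y[of k] pq(2)[of k] unfolding half(1) by linarith
        moreover have "\<bar>fst p - fst q\<bar> \<le> (1/2) ^ n" using pq(1) half by linarith
        ultimately have 2: "(fst p, y) \<in> I_box ((1/2) ^ n) (fst q) (snd q)"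
          by (simp add: I_box_def)
        have "2 * ?c < norm (u (fst p) y \<omega> - u (fst p) (snd p) \<omega>)"
          using less component_le_norm_cart[of "u (fst p) y \<omega> - u (fst p) (snd p) \<omega>" j] by simp
        also have "\<dots> \<le> norm (u (fst p) y \<omega> - ?f q) + norm (?f p - ?f q)"
          using norm_triangle_ineq4[of "u (fst p) y \<omega> - ?f q" "?f p - ?f q"] by simp
        \<comment> \<open>Since the increment exceeds \<open>2 * ?c\<close>, q differs by at least
          \<open>?c\<close> from one of the two points; this is the factor 1/2 in the
          constant.\<close>
        finally have "?c \<le> norm (?f (fst p, y) - ?f q) \<or> ?c \<le> norm (?f p - ?f q)" by auto
        then show "\<exists>p\<in>I_box ((1/2) ^ n) (fst q) (snd q). ?c \<le> norm (?f p - ?f q)"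
          using 1 2 by blast
      qed
    qed
    then show ?case
      using const by (intro Liminf_oscillation_ge anti pos doubling) auto
  qed
qed

section \<open>Nondifferentiability and the two choices of scale\<close>

lemma differentiable_imp_oscillation_le:
  fixes f :: "real \<times> (real^'n) \<Rightarrow> 'b::real_normed_vector"
  assumes "f differentiable (at q)"
  shows "\<exists>K\<ge>0. eventually (\<lambda>r. \<forall>p\<in>I_box r (fst q) (snd q). norm (f p - f q) \<le> K * r) (at_right 0)"
proof -
  obtain f' where f': "(f has_derivative f') (at q)" using assms unfolding differentiable_def by blast
  then have bl: "bounded_linear f'" by (rule has_derivative_bounded_linear)
  obtain B where B: "0 \<le> B" "\<And>x. norm (f' x) \<le> norm x * B"
    using bounded_linear.nonneg_bounded[OF bl] by blast
  obtain d where d: "0 < d" "\<And>p. norm (p - q) < d \<Longrightarrow> norm (f p - f q - f' (p - q)) \<le> 1 * norm (p - q)"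
    using f' unfolding has_derivative_at_alt by (meson zero_less_one)
  \<comment> \<open>Compares the box with the norm: the norm is at most the sum of the 1 + N
    coordinates, each bounded by r.\<close>
  define m where "m = 1 + real CARD('n)"
  have m: "0 < m" by (simp add: m_def add_pos_nonneg)
  have "eventually (\<lambda>r::real. r \<in> {0<..<d / m}) (at_right 0)"
    using d m by (intro eventually_at_right_real) simp
  then have "eventually (\<lambda>r. \<forall>p\<in>I_box r (fst q) (snd q). norm (f p - f q) \<le> ((B + 1) * m) * r) (at_right 0)"
  proof eventually_elim
    case (elim r)
    then have r: "0 < r" "m * r < d" using m by (auto simp: field_simps)
    show ?case
    proof
      fix p assume p: "p \<in> I_box r (fst q) (snd q)"
      have "norm (p - q) \<le> norm (fst (p - q)) + norm (snd (p - q))"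
        using norm_Pair_le[of "fst (p - q)" "snd (p - q)"] by (simp only: prod.collapse)
      also have "norm (snd (p - q)) \<le> (\<Sum>k\<in>UNIV. \<bar>snd (p - q) $ k\<bar>)" by (rule norm_le_l1_cart)
      also have "norm (fst (p - q)) + (\<Sum>k\<in>UNIV. \<bar>snd (p - q) $ k\<bar>) \<le> r + (\<Sum>k\<in>(UNIV :: 'n set). r)"
        using p by (intro add_mono sum_mono) (auto simp: I_box_def)
      also have "\<dots> = m * r" by (simp add: m_def algebra_simps)
      finally have le: "norm (p - q) \<le> m * r" by simp
      have "norm (f p - f q) \<le> norm (f p - f q - f' (p - q)) + norm (f' (p - q))"
        using norm_triangle_ineq[of "f p - f q - f' (p - q)" "f' (p - q)"] by simp
      also have "\<dots> \<le> norm (p - q) + norm (p - q) * B"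
        using d(2)[of p] le r B(2)[of "p - q"] by (intro add_mono) auto
      also have "\<dots> = (B + 1) * norm (p - q)" by (simp add: algebra_simps)
      also have "\<dots> \<le> (B + 1) * (m * r)" using le B by (intro mult_left_mono) auto
      finally show "norm (f p - f q) \<le> ((B + 1) * m) * r" by (simp add: mult.assoc)
    qed
  qed
  then show ?thesis using B m by (intro exI[of _ "(B + 1) * m"]) auto
qed

text \<open>Oscillation of order r divided by the normalisation is of order r^(1-\<alpha>)
  log(1/r)^\<alpha>, which tends to 0 as \<alpha> < 1. The infimum over \<open>T\<close> is at most
  its value at q.\<close>

lemma Liminf_oscillation_pos_imp_not_differentiable:
  fixes f :: "real \<times> (real^'n) \<Rightarrow> 'b::real_normed_vector"
  assumes C: "0 < C" and \<alpha>: "0 < \<alpha>" "\<alpha> < 1" and q: "q \<in> T"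
    and le: "ereal C \<le> Liminf (at_right 0) (\<lambda>r. INF q\<in>T. SUP p\<in>I_box r (fst q) (snd q).
          ereal (norm (f p - f q) / (r powr \<alpha> * ln (1 / r) powr - \<alpha>)))"
  shows "\<not> f differentiable (at q)"
proof
  assume "f differentiable (at q)"
  then obtain K where K: "0 \<le> K"
    "eventually (\<lambda>r. \<forall>p\<in>I_box r (fst q) (snd q). norm (f p - f q) \<le> K * r) (at_right 0)"
    using differentiable_imp_oscillation_le by blast
  have "((\<lambda>r. K * (r / (r powr \<alpha> * ln (1 / r) powr - \<alpha>))) \<longlongrightarrow> K * 0) (at_right 0)"
    using \<alpha> by (intro tendsto_mult tendsto_const) real_asymp
  then have lim: "eventually (\<lambda>r. K * (r / (r powr \<alpha> * ln (1 / r) powr - \<alpha>)) < C / 2) (at_right 0)"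
    using C by (intro order_tendstoD(2)) auto
  have "ereal (C / 2) < ereal C" using C by simp
  also note le
  finally have "eventually (\<lambda>r. ereal (C / 2) < (INF q\<in>T. SUP p\<in>I_box r (fst q) (snd q).
          ereal (norm (f p - f q) / (r powr \<alpha> * ln (1 / r) powr - \<alpha>)))) (at_right 0)"
    by (rule less_LiminfD)
  moreover have "eventually (\<lambda>r::real. r \<in> {0<..<1}) (at_right 0)"
    by (rule eventually_at_right_real) simp
  ultimately have "eventually (\<lambda>r::real. False) (at_right 0)"
    using K(2) lim
  proof eventually_elim
    case (elim r)
    have den: "0 < r powr \<alpha> * ln (1 / r) powr - \<alpha>" using elim by simp
    have "(INF q\<in>T. SUP p\<in>I_box r (fst q) (snd q). ereal (norm (f p - f q) / (r powr \<alpha> * ln (1 / r) powr - \<alpha>)))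
      \<le> (SUP p\<in>I_box r (fst q) (snd q). ereal (norm (f p - f q) / (r powr \<alpha> * ln (1 / r) powr - \<alpha>)))"
      by (rule INF_lower[OF q])
    also have "\<dots> \<le> ereal (K * (r / (r powr \<alpha> * ln (1 / r) powr - \<alpha>)))"
    proof (rule SUP_least)
      fix p assume "p \<in> I_box r (fst q) (snd q)"
      then have "norm (f p - f q) \<le> K * r" using elim by blast
      then have "norm (f p - f q) / (r powr \<alpha> * ln (1 / r) powr - \<alpha>) \<le> K * r / (r powr \<alpha> * ln (1 / r) powr - \<alpha>)"
        using den by (intro divide_right_mono) auto
      then show "ereal (norm (f p - f q) / (r powr \<alpha> * ln (1 / r) powr - \<alpha>)) \<le> ereal (K * (r / (r powr \<alpha> * ln (1 / r) powr - \<alpha>)))"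
        by simp
    qed
    also have "\<dots> < ereal (C / 2)" using elim by simp
    finally show False using elim by simp
  qed
  then show False by simp
qed

text \<open>The grid is the single point itself. With \<theta> = 1/2 the failure probability along r
  = 2^(-n) is of order exp(-2 ln (n ln 2)), that is 1/n^2.\<close>

lemma AE_Liminf_single_point:
  fixes M :: "'w measure" and u :: "real \<Rightarrow> real^'n \<Rightarrow> 'w \<Rightarrow> real^'d" and q :: "real \<times> (real^'n)"
  assumes M: "prob_space M"
    and u: "\<And>t x. u t x \<in> borel_measurable M"
    and small_ball: "\<And>t x \<delta> n. t0 \<le> t \<Longrightarrow> 0 < \<delta> \<Longrightarrow> \<delta> \<le> \<delta>0 \<Longrightarrow>
      measure M {\<omega>\<in>space M. \<forall>k\<in>{1..n::nat}. \<bar>u t (x + (real k * \<delta>) *\<^sub>R axis i 1) \<omega> $ j - u t x \<omega> $ j\<bar> \<le> s * \<delta> powr \<alpha>}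
        \<le> exp (- real n)"
    and const: "0 < \<delta>0" "0 < s" "0 \<le> \<alpha>"
    and q: "t0 \<le> fst q"
  shows "AE \<omega> in M. ereal (s / 2 * ((1/2) / 2) powr \<alpha> * 4 powr - \<alpha>) \<le>
    Liminf (at_right 0) (\<lambda>r. SUP p\<in>I_box r (fst q) (snd q).
      ereal (norm (u (fst p) (snd p) \<omega> - u (fst q) (snd q) \<omega>) / (r powr \<alpha> * ln (ln (1 / r)) powr - \<alpha>)))"
proof -
  have dy: "ln (1 / (1/2) ^ n) = real n * ln 2" for n :: nat
    by (simp add: power_one_over ln_realpow)
  have "AE \<omega> in M. ereal (s / 2 * ((1/2) / 2) powr \<alpha> * 4 powr - \<alpha>) \<le>
    Liminf (at_right 0) (\<lambda>r. INF q\<in>{q}. SUP p\<in>I_box r (fst q) (snd q).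
      ereal (norm (u (fst p) (snd p) \<omega> - u (fst q) (snd q) \<omega>) / (r powr \<alpha> * (\<lambda>r. ln (ln (1 / r))) r powr - \<alpha>)))"
  proof (rule AE_Liminf_oscillation_ge[OF M u small_ball const(1) _ const(2,3), where D = "\<lambda>_. {q}"])
    show "eventually (\<lambda>n. \<forall>q'\<in>{q}. \<exists>p\<in>{q}. p \<in> I_box ((1/2) ^ Suc n) (fst q') (snd q')) sequentially"
      by (simp add: I_box_def split_beta')
    have "eventually (\<lambda>n. norm (real (card {q}) * exp (- (ln (ln (1 / (1/2) ^ n)) / (1/2)))) \<le> (1 / (ln 2)\<^sup>2) * inverse (real n ^ 2)) sequentially"
      using eventually_gt_at_top[of 0]
    proof eventually_elim
      case (elim n)
      have "0 < real n * ln 2" using elim by simp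
      have "exp (- (ln (ln (1 / (1/2) ^ n)) / (1/2))) = exp (- (ln (real n * ln 2) + ln (real n * ln 2)))"
        by (simp only: dy) simp
      also have "\<dots> = 1 / (real n * ln 2)\<^sup>2"
        using \<open>0 < real n * ln 2\<close> by (simp only: exp_minus exp_add exp_ln) (simp add: power2_eq_square field_simps)
      finally show ?case by (simp add: power_mult_distrib field_simps)
    qed
    then show "summable (\<lambda>n. real (card {q}) * exp (- (ln (ln (1 / (1/2) ^ n)) / (1/2))))"
      by (rule summable_comparison_test_ev) (intro summable_mult inverse_power_summable, simp)
    show "ln (ln (1 / r')) \<le> ln (ln (1 / r))" if "0 < r" "r \<le> r'" "r' < 1" for r r' :: real
      using that by (simp add: ln_le_cancel_iff frac_le)
    show "eventually (\<lambda>n. 1 \<le> ln (ln (1 / (1/2 :: real) ^ n))) sequentially"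
      unfolding dy by real_asymp
    show "eventually (\<lambda>n. ln (ln (1 / (1/2 :: real) ^ Suc n)) \<le> 2 * ln (ln (1 / (1/2) ^ n))) sequentially"
      unfolding dy by real_asymp
  qed (use q in auto)
  then show ?thesis by simp
qed

lemma AE_Liminf_box:
  fixes M :: "'w measure" and u :: "real \<Rightarrow> real^'n \<Rightarrow> 'w \<Rightarrow> real^'d" and a b :: "real \<times> (real^'n)"
  assumes M: "prob_space M"
    and u: "\<And>t x. u t x \<in> borel_measurable M"
    and small_ball: "\<And>t x \<delta> n. fst a / 2 \<le> t \<Longrightarrow> 0 < \<delta> \<Longrightarrow> \<delta> \<le> \<delta>0 \<Longrightarrow>
      measure M {\<omega>\<in>space M. \<forall>k\<in>{1..n::nat}. \<bar>u t (x + (real k * \<delta>) *\<^sub>R axis i 1) \<omega> $ j - u t x \<omega> $ j\<bar> \<le> s * \<delta> powr \<alpha>}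
        \<le> exp (- real n)"
    and const: "0 < \<delta>0" "0 < s" "0 \<le> \<alpha>"
    and a: "0 < fst a"
  shows "\<exists>C>0. AE \<omega> in M. ereal C \<le>
    Liminf (at_right 0) (\<lambda>r. INF q\<in>cbox a b. SUP p\<in>I_box r (fst q) (snd q).
      ereal (norm (u (fst p) (snd p) \<omega> - u (fst q) (snd q) \<omega>) / (r powr \<alpha> * ln (1 / r) powr - \<alpha>)))"
proof -
  obtain R and D :: "nat \<Rightarrow> (real \<times> (real^'n)) set" where R: "0 \<le> R"
    and D: "\<And>n. finite (D n)" "\<And>n. real (card (D n)) \<le> (R * 2 ^ n) ^ Suc CARD('n)"
      "\<And>n p. p \<in> D n \<Longrightarrow> fst a / 2 \<le> fst p"
      "eventually (\<lambda>n. \<forall>q\<in>cbox a b. \<exists>p\<in>D n. p \<in> I_box ((1/2) ^ Suc n) (fst q) (snd q)) sequentially"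
    using dyadic_grid[OF a, of b] by blast
  have dy: "ln (1 / (1/2) ^ n) = real n * ln 2" for n :: nat
    by (simp add: power_one_over ln_realpow)
  \<comment> \<open>The failure probability 2^(-n m) has to beat (R 2^n)^(N+1) grid points; m = N +
    2 leaves the geometric factor 2^(-n).\<close>
  define m where "m = CARD('n) + 2"
  define \<theta> where "\<theta> = 1 / real m"
  have \<theta>: "0 < \<theta>" by (simp add: \<theta>_def m_def)
  have "AE \<omega> in M. ereal (s / 2 * (\<theta> / 2) powr \<alpha> * 4 powr - \<alpha>) \<le>
    Liminf (at_right 0) (\<lambda>r. INF q\<in>cbox a b. SUP p\<in>I_box r (fst q) (snd q).
      ereal (norm (u (fst p) (snd p) \<omega> - u (fst q) (snd q) \<omega>) / (r powr \<alpha> * (\<lambda>r. ln (1 / r)) r powr - \<alpha>)))"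
  proof (rule AE_Liminf_oscillation_ge[OF M u small_ball const(1) \<theta> const(2,3) D(1) D(3) D(4)])
    have "norm (real (card (D n)) * exp (- (ln (1 / (1/2) ^ n) / \<theta>))) \<le> R ^ Suc CARD('n) * (1/2) ^ n" for n
    proof -
      have "exp (- (ln (1 / (1/2) ^ n) / \<theta>)) = exp (real (n * m) * - ln 2)"
        unfolding dy by (simp add: \<theta>_def)
      also have "\<dots> = (1/2) ^ (n * m)"
        by (simp only: exp_of_nat_mult) (simp add: exp_minus inverse_eq_divide)
      finally have e: "exp (- (ln (1 / (1/2) ^ n) / \<theta>)) = (1/2) ^ (n * m)" .
      have "real (card (D n)) * (1/2) ^ (n * m) \<le> (R * 2 ^ n) ^ Suc CARD('n) * (1/2) ^ (n * m)"
        using D(2) by (rule mult_right_mono) simp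
      also have "\<dots> = (R * 2 ^ n) ^ Suc CARD('n) * (1/2) ^ (n * Suc CARD('n) + n)"
      proof -
        have "n * m = n * Suc CARD('n) + n" by (simp add: m_def)
        then show ?thesis by (simp only:)
      qed
      also have "(R * 2 ^ n) ^ Suc CARD('n) * (1/2) ^ (n * Suc CARD('n) + n)
        = R ^ Suc CARD('n) * (1/2) ^ n * ((2 ^ n) ^ Suc CARD('n) * ((1/2) ^ n) ^ Suc CARD('n))"
        by (simp only: power_mult_distrib power_add power_mult mult_ac)
      also have "(2 ^ n) ^ Suc CARD('n) * ((1/2) ^ n) ^ Suc CARD('n) = (1::real)"
        by (simp only: power_mult_distrib[symmetric]) simp
      finally show ?thesis unfolding e by simp
    qed
    then show "summable (\<lambda>n. real (card (D n)) * exp (- (ln (1 / (1/2) ^ n) / \<theta>)))"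
      by (intro summable_comparison_test'[OF summable_mult[OF summable_geometric]]) auto
    show "ln (1 / r') \<le> ln (1 / r)" if "0 < r" "r \<le> r'" "r' < 1" for r r' :: real
      using that by (simp add: ln_le_cancel_iff frac_le)
    show "eventually (\<lambda>n. 1 \<le> ln (1 / (1/2 :: real) ^ n)) sequentially"
      unfolding dy by real_asymp
    show "eventually (\<lambda>n. ln (1 / (1/2 :: real) ^ Suc n) \<le> 2 * ln (1 / (1/2) ^ n)) sequentially"
      unfolding dy by real_asymp
  qed
  moreover have "0 < s / 2 * (\<theta> / 2) powr \<alpha> * 4 powr - \<alpha>" using const \<theta> by simp
  ultimately show ?thesis by blast
qed

theorem theorem5p5:
  fixes M :: "'w measure"
    and u :: "real \<Rightarrow> real^'n \<Rightarrow> 'w \<Rightarrow> real^'d"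
    and h :: "real^'n \<Rightarrow> real"
    and H \<beta> c1 c2 cH :: real
    and a b :: "real \<times> (real^'n)"
  assumes H: "1/2 \<le> H" "H < 1"
    and beta: "0 < \<beta>" "\<beta> < real CARD('n)"
    and beta2: "real CARD('n) - 2 * H - 1 < \<beta>" "\<beta> < real CARD('n) - 2 * H + 1"
    and h_meas: "h \<in> borel_measurable lborel"
    and h_nonneg: "\<forall>\<xi>. 0 \<le> h \<xi>"
    and c12: "0 < c1" "c1 \<le> c2"
    and h_bounds: "\<forall>\<xi>. \<xi> \<noteq> 0 \<longrightarrow>
        c1 * norm \<xi> powr (- \<beta>) \<le> h \<xi> \<and> h \<xi> \<le> c2 * norm \<xi> powr (- \<beta>)"
    and cH: "0 < cH"
    and M: "prob_space M"
    and u_meas: "\<forall>t x. u t x \<in> borel_measurable M"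
    and u_gauss: "\<forall>S (c :: real \<times> (real^'n) \<Rightarrow> real^'d). finite S \<longrightarrow> S \<subseteq> {p. 0 \<le> fst p} \<longrightarrow>
        centered_gaussian_rv M (\<lambda>\<omega>. \<Sum>p\<in>S. c p \<bullet> u (fst p) (snd p) \<omega>)"
    and u_cov: "\<forall>t x s y j k. 0 \<le> t \<longrightarrow> 0 \<le> s \<longrightarrow>
        complex_of_real (prob_space.expectation M (\<lambda>\<omega>. u t x \<omega> $ j * u s y \<omega> $ k))
          = (if j = k then wave_cov cH H h t x s y else 0)"
    and u_cont: "AE \<omega> in M. continuous_on ({0..} \<times> UNIV) (\<lambda>p. u (fst p) (snd p) \<omega>)"
    and T_pos: "0 < fst a"
  defines "\<alpha> \<equiv> (2 * H + 1 - real CARD('n) + \<beta>) / 2"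
    and "T \<equiv> cbox a b"
  shows "\<exists>C3 C4. 0 < C3 \<and> 0 < C4 \<and>
    (\<forall>q\<in>T. AE \<omega> in M.
       Liminf (at_right 0) (\<lambda>r. SUP p\<in>I_box r (fst q) (snd q).
          ereal (norm (u (fst p) (snd p) \<omega> - u (fst q) (snd q) \<omega>)
                 / (r powr \<alpha> * ln (ln (1 / r)) powr (- \<alpha>)))) \<ge> ereal C3) \<and>
    (AE \<omega> in M.
       Liminf (at_right 0) (\<lambda>r. INF q\<in>T. SUP p\<in>I_box r (fst q) (snd q).
          ereal (norm (u (fst p) (snd p) \<omega> - u (fst q) (snd q) \<omega>)
                 / (r powr \<alpha> * ln (1 / r) powr (- \<alpha>)))) \<ge> ereal C4) \<and>
    (AE \<omega> in M. \<forall>t x. 0 < t \<longrightarrow>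
       \<not> ((\<lambda>p. u (fst p) (snd p) \<omega>) differentiable (at (t, x))))"
proof -
  interpret prob_space M by fact
  have \<alpha>: "0 < \<alpha>" "\<alpha> < 1" using beta2 by (auto simp: \<alpha>_def)
  have \<alpha>0: "0 \<le> \<alpha>" using \<alpha> by simp
  have um: "u t x \<in> borel_measurable M" for t x using u_meas by blast
  \<comment> \<open>One component and one spatial direction suffice, because the norm dominates each
    component; \<open>undefined\<close> makes an arbitrary choice of both.\<close>
  have small_ball: "\<exists>s>0. \<forall>t x \<delta> n. t0 \<le> t \<longrightarrow> 0 < \<delta> \<longrightarrow> \<delta> \<le> t0 / 8 \<longrightarrow>
    measure M {\<omega>\<in>space M. \<forall>k\<in>{1..n::nat}.
      \<bar>u t (x + (real k * \<delta>) *\<^sub>R axis (undefined :: 'n) 1) \<omega> $ (undefined :: 'd) - u t x \<omega> $ undefined\<bar> \<le> s * \<delta> powr \<alpha>}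
      \<le> exp (- real n)" if "0 < t0" for t0
    by (rule wave_small_ball[OF H beta beta2(1) h_meas h_nonneg c12 h_bounds cH M u_meas u_gauss u_cov that])
       (rule \<alpha>_def[THEN meta_eq_to_obj_eq])
  have box: "\<exists>C>0. AE \<omega> in M. ereal C \<le>
    Liminf (at_right 0) (\<lambda>r. INF q\<in>cbox a' b'. SUP p\<in>I_box r (fst q) (snd q).
      ereal (norm (u (fst p) (snd p) \<omega> - u (fst q) (snd q) \<omega>) / (r powr \<alpha> * ln (1 / r) powr - \<alpha>)))"
    if a': "0 < fst a'" for a' b' :: "real \<times> (real^'n)"
  proof -
    obtain s where s: "0 < s" and sb: "\<And>t x \<delta> n. fst a' / 2 \<le> t \<Longrightarrow> 0 < \<delta> \<Longrightarrow> \<delta> \<le> fst a' / 2 / 8 \<Longrightarrow>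
      measure M {\<omega>\<in>space M. \<forall>k\<in>{1..n::nat}.
        \<bar>u t (x + (real k * \<delta>) *\<^sub>R axis (undefined :: 'n) 1) \<omega> $ (undefined :: 'd) - u t x \<omega> $ undefined\<bar> \<le> s * \<delta> powr \<alpha>}
        \<le> exp (- real n)"
      using small_ball[of "fst a' / 2"] a' by auto
    show ?thesis
      by (rule AE_Liminf_box[where ?\<delta>0.0 = "fst a' / 2 / 8", OF M um sb _ s \<alpha>0 a']) (use a' in auto)
  qed
  \<comment> \<open>Chosen before the point: every q in \<open>T\<close> has time at least
    \<open>fst a\<close>, so C3 is common to all of \<open>T\<close>.\<close>
  obtain s where s: "0 < s" and sb: "\<And>t x \<delta> n. fst a \<le> t \<Longrightarrow> 0 < \<delta> \<Longrightarrow> \<delta> \<le> fst a / 8 \<Longrightarrow>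
    measure M {\<omega>\<in>space M. \<forall>k\<in>{1..n::nat}.
      \<bar>u t (x + (real k * \<delta>) *\<^sub>R axis (undefined :: 'n) 1) \<omega> $ (undefined :: 'd) - u t x \<omega> $ undefined\<bar> \<le> s * \<delta> powr \<alpha>}
      \<le> exp (- real n)"
    using small_ball[OF T_pos] by blast
  have point: "AE \<omega> in M. ereal (s / 2 * ((1/2) / 2) powr \<alpha> * 4 powr - \<alpha>) \<le>
    Liminf (at_right 0) (\<lambda>r. SUP p\<in>I_box r (fst q) (snd q).
      ereal (norm (u (fst p) (snd p) \<omega> - u (fst q) (snd q) \<omega>) / (r powr \<alpha> * ln (ln (1 / r)) powr - \<alpha>)))"
    if "q \<in> T" for q
  proof (rule AE_Liminf_single_point[where ?\<delta>0.0 = "fst a / 8", OF M um sb _ s \<alpha>0])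
    show "fst a \<le> fst q" using that by (cases a; cases b; cases q) (auto simp: T_def cbox_Pair_eq)
  qed (use T_pos in auto)
  have nowhere: "AE \<omega> in M. \<forall>t x. 0 < t \<longrightarrow> \<not> ((\<lambda>p. u (fst p) (snd p) \<omega>) differentiable (at (t, x)))"
  proof -
    \<comment> \<open>Countably many compact boxes exhausting the open half space; a countable union
      of null sets gives one exceptional set for all points. \<open>Q 0\<close> is empty, which is
      harmless.\<close>
    define Q where "Q m = cbox (1 / real (Suc m), \<chi> i. - real m) (real m, \<chi> i. real m :: real^'n)" for m :: nat
    define osc where "osc m \<omega> = Liminf (at_right 0) (\<lambda>r. INF q\<in>Q m. SUP p\<in>I_box r (fst q) (snd q).
        ereal (norm (u (fst p) (snd p) \<omega> - u (fst q) (snd q) \<omega>) / (r powr \<alpha> * ln (1 / r) powr - \<alpha>)))" for m \<omega>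
    have "\<exists>C. 0 < C \<and> (AE \<omega> in M. ereal C \<le> osc m \<omega>)" for m
      unfolding Q_def osc_def by (rule box) simp
    then have "\<exists>C. \<forall>m. 0 < C m \<and> (AE \<omega> in M. ereal (C m) \<le> osc m \<omega>)"
      by (intro choice allI)
    then obtain C where C: "\<And>m. 0 < C m" "\<And>m. AE \<omega> in M. ereal (C m) \<le> osc m \<omega>"
      by blast
    have "AE \<omega> in M. \<forall>m. ereal (C m) \<le> osc m \<omega>"
      using C(2) by (simp add: AE_all_countable)
    then show ?thesis
    proof eventually_elim
      case (elim \<omega>)
      show ?case
      proof (intro allI impI)
        fix t :: real and x :: "real^'n" assume t: "0 < t"
        obtain m1 where m1: "1 / real (Suc m1) < t" using nat_approx_posE[OF t] by blast
        obtain m2 where m2: "max t (norm x) \<le> real m2" using real_arch_simple by blast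
        define m where "m = max m1 m2"
        have "1 / real (Suc m) \<le> 1 / real (Suc m1)" by (intro divide_left_mono) (auto simp: m_def)
        then have t1: "1 / real (Suc m) \<le> t" using m1 by simp
        have "real m2 \<le> real m" by (simp add: m_def)
        then have t2: "t \<le> real m" and nx: "norm x \<le> real m" using m2 by auto
        have x: "- real m \<le> x $ k" "x $ k \<le> real m" for k
          using component_le_norm_cart[of x k] nx by linarith+
        have "(t, x) \<in> Q m" unfolding Q_def cbox_Pair_eq using t1 t2 x by (auto simp: mem_box_cart)
        then show "\<not> ((\<lambda>p. u (fst p) (snd p) \<omega>) differentiable (at (t, x)))"
          using elim[rule_format, of m] unfolding osc_def
          by (rule Liminf_oscillation_pos_imp_not_differentiable[OF C(1) \<alpha>])
      qed
    qed
  qed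
  obtain C4 where C4: "0 < C4" "AE \<omega> in M. ereal C4 \<le>
    Liminf (at_right 0) (\<lambda>r. INF q\<in>T. SUP p\<in>I_box r (fst q) (snd q).
      ereal (norm (u (fst p) (snd p) \<omega> - u (fst q) (snd q) \<omega>) / (r powr \<alpha> * ln (1 / r) powr - \<alpha>)))"
    unfolding T_def using box[OF T_pos] by blast
  have "0 < s / 2 * ((1/2) / 2) powr \<alpha> * 4 powr - \<alpha>" using s by simp
  then show ?thesis using C4 point nowhere
    by (intro exI[of _ "s / 2 * ((1/2) / 2) powr \<alpha> * 4 powr - \<alpha>"] exI[of _ C4] conjI ballI)
qed

end
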